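(* Consider the streaming sampling scheme, the quantities $q_{e,t}$ and the estimators $\hat C_{e,t}$ described in the context, and fix an edge $e\in K$ and a time $t\ge1$. Let $\mathcal F_s$ denote the information generated by the first $s$ arrivals (the $\sigma$-algebra generated by the uniform variables assigned at admissions up to time $s$). Suppose $\hat V_{e,t-1}$ is $\mathcal F_{t-1}$-measurable and $\mathbb E[\hat V_{e,t-1}]=\mathrm{Var}(\hat C_{e,t-1})$. Then $$\hat V_{e,t}=\hat C_{e,t}^2\,(1-q_{e,t})+\mathbf 1[e\in\hat K_t]\,\frac{\hat V_{e,t-1}}{q_{e,t}}$$ (interpreted as $0$ in the second term when $e\notin\hat K_t$) is $\mathcal F_t$-measurable and satisfies $\mathbb E[\hat V_{e,t}]=\mathrm{Var}(\hat C_{e,t})$.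
   Context: Let $K$ be a finite set of edges (unordered vertex pairs) and let $e_1,e_2,\dots,e_T\in K$ be a fixed, deterministic stream of interactions indexed by discrete time $t=1,\dots,T$ (the same edge may occur many times). For $e\in K$ put $c_{e,t}=1$ if $e_t=e$ and $c_{e,t}=0$ otherwise, $C_{e,t}=\sum_{s\le t}c_{e,s}$. Sampling scheme (reservoir of capacity $m\ge1$): $\hat K_0=\emptyset$. At time $t$: if $e_t\in\hat K_{t-1}$ then $\hat K_t=\hat K_{t-1}$. Otherwise $e_t$ is admitted: it receives a fresh random variable $u_{e_t}$, uniform on $(0,1]$ and independent of everything else (a new one at each admission), and $\hat K'_t=\hat K_{t-1}\cup\{e_t\}$. If $|\hat K'_t|\le m$ then $\hat K_t=\hat K'_t$. Otherwise ($|\hat K_{t-1}|=m$; let $\Omega$ be the set of such "sampling times") every $i\in\hat K'_t$ has a weight $w_{i,t}>0$, determined by the deterministic arrival sequence and the time of the most recent admission of $i$, and priority $r_{i,t}=w_{i,t}/u_i$; the element of minimal priority is discarded, $\hat K_t=\hat K'_t\setminus\{\arg\min_{i\in\hat K'_t}r_{i,t}\}$. For $t\in\Omega$ let $z_t=\min_{i\in\hat K'_t}r_{i,t}$. For $t\in\Omega$ and $e\in\hat K'_t$, let $a_e(t)\le t$ be the most recent admission time of $e$, let $\pi_{e,t}=p_{e,s}$ with $s=\max(\Omega\cap[a_e(t),t))$ if this set is nonempty and $\pi_{e,t}=1$ otherwise, and $p_{e,t}=\min\{\pi_{e,t},w_{e,t}/z_t\}$. Define $q_{e,t}=1$ if $t\notin\Omega$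 and $q_{e,t}=p_{e,t}/\pi_{e,t}$ if $t\in\Omega$, $e\in\hat K'_t$. Estimator: $\hat C_{e,0}=0$ and $\hat C_{e,t}=(\hat C_{e,t-1}+c_{e,t})\,\mathbf 1[e\in\hat K_t]/q_{e,t}$ (zero when $e\notin\hat K_t$). At $t\in\Omega$, for $e\in\hat K'_t$, $\mathbf 1[e\in\hat K_t]=\mathbf 1[u_e<w_{e,t}/z_t]$.
   Formalization: Added assumption (the claim fails without it): V̂_{e,t-1} is 0 when e is not in K̂_{t-1} and does not use the exact value of the uniform variable e currently holds; V̂_{e,t} is shown to inherit this. Var may be infinite, with E[V̂]=Var read in the extended sense. *)

theory Defs
  imports "HOL-Probability.Probability" "HOL-Library.Uprod"
begin

section \<open>The reservoir scheme\<close>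

text \<open>
  The arrival sequence is deterministic and indexed by the times 1, 2, and so on; the value at time 0 is
  never used. \<open>weight S i a t\<close> is the weight at time \<open>t\<close> of the edge \<open>i\<close> if its most recent
  admission took place at time \<open>a\<close>. As the arrival sequence is a component of \<open>S\<close>, every weight
  determined by it and by the admission time is of this form.
\<close>

record 'v scheme =
  arrival :: "nat \<Rightarrow> 'v uprod"
  capacity :: nat
  weight :: "'v uprod \<Rightarrow> nat \<Rightarrow> nat \<Rightarrow> real"

text \<open>
  The scheme is run on one realisation \<open>u\<close> of a sequence of variables indexed by time: \<open>u t\<close> is the
  fresh variable given to the arriving edge if that edge is admitted at time \<open>t\<close>, and it plays no
  role otherwise. The state is the current sample together with the most recent admission time of
  every edge (0 before the first admission).
\<close>

primrec state ::
  "'v scheme \<Rightarrow> (nat \<Rightarrow> real) \<Rightarrow> nat \<Rightarrow> 'v uprod set \<times> ('v uprod \<Rightarrow> nat)" where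
  "state S u 0 = ({}, \<lambda>_. 0)"
| "state S u (Suc n) =
    (let t = Suc n; x = arrival S t; K = fst (state S u n); a = snd (state S u n);
         K' = insert x K; a' = a(x := t)
     in if x \<in> K then (K, a)
        else if card K' \<le> capacity S then (K', a')
        else (K' - {arg_min_on (\<lambda>i. weight S i (a' i) t / u (a' i)) K'}, a'))"

definition sample :: "'v scheme \<Rightarrow> (nat \<Rightarrow> real) \<Rightarrow> nat \<Rightarrow> 'v uprod set" where
  "sample S u t = fst (state S u t)"

definition adm_time :: "'v scheme \<Rightarrow> (nat \<Rightarrow> real) \<Rightarrow> 'v uprod \<Rightarrow> nat \<Rightarrow> nat" where
  "adm_time S u e t = snd (state S u t) e"

definition presample :: "'v scheme \<Rightarrow> (nat \<Rightarrow> real) \<Rightarrow> nat \<Rightarrow> 'v uprod set" where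
  "presample S u t = insert (arrival S t) (sample S u (t - 1))"

definition admitted_at :: "'v scheme \<Rightarrow> (nat \<Rightarrow> real) \<Rightarrow> nat \<Rightarrow> bool" where
  "admitted_at S u t \<longleftrightarrow> 1 \<le> t \<and> arrival S t \<notin> sample S u (t - 1)"

definition sampling_time :: "'v scheme \<Rightarrow> (nat \<Rightarrow> real) \<Rightarrow> nat \<Rightarrow> bool" where
  "sampling_time S u t \<longleftrightarrow> admitted_at S u t \<and> capacity S < card (presample S u t)"

definition cur_weight :: "'v scheme \<Rightarrow> (nat \<Rightarrow> real) \<Rightarrow> 'v uprod \<Rightarrow> nat \<Rightarrow> real" where
  "cur_weight S u e t = weight S e (adm_time S u e t) t"

definition priority :: "'v scheme \<Rightarrow> (nat \<Rightarrow> real) \<Rightarrow> 'v uprod \<Rightarrow> nat \<Rightarrow> real" where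
  "priority S u e t = cur_weight S u e t / u (adm_time S u e t)"

definition threshold :: "'v scheme \<Rightarrow> (nat \<Rightarrow> real) \<Rightarrow> nat \<Rightarrow> real" where
  "threshold S u t = Min ((\<lambda>i. priority S u i t) ` presample S u t)"

lemma sample_0: "sample S u 0 = {}"
  by (simp add: sample_def)

lemma sample_Suc:
  "sample S u (Suc n) =
    (if arrival S (Suc n) \<in> sample S u n then sample S u n
     else if card (presample S u (Suc n)) \<le> capacity S then presample S u (Suc n)
     else presample S u (Suc n)
       - {arg_min_on (\<lambda>i. priority S u i (Suc n)) (presample S u (Suc n))})"
  by (simp add: sample_def adm_time_def presample_def priority_def cur_weight_def Let_def)

lemma adm_time_Suc:
  "adm_time S u e (Suc n) =
    (if admitted_at S u (Suc n) \<and> arrival S (Suc n) = e then Suc n else adm_time S u e n)"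
  by (auto simp: sample_def adm_time_def admitted_at_def Let_def)

lemma adm_time_eq_Max:
  "adm_time S u e t = Max (insert 0 {s \<in> {1..t}. admitted_at S u s \<and> arrival S s = e})"
proof (induction t)
  case 0
  then show ?case by (simp add: adm_time_def)
next
  case (Suc t)
  let ?A = "\<lambda>t. {s \<in> {1..t}. admitted_at S u s \<and> arrival S s = e}"
  show ?case
  proof (cases "admitted_at S u (Suc t) \<and> arrival S (Suc t) = e")
    case True
    have "Max (insert 0 (?A (Suc t))) = Suc t"
      using True by (intro Max_eqI) auto
    with True show ?thesis by (simp add: adm_time_Suc)
  next
    case False
    then have "?A (Suc t) = ?A t" by (auto simp: le_Suc_eq)
    with False Suc show ?thesis by (auto simp add: adm_time_Suc simp del: atLeastAtMost_iff)
  qed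
qed


section \<open>Retention probabilities and the estimator\<close>

definition prior_sampling_times ::
  "'v scheme \<Rightarrow> (nat \<Rightarrow> real) \<Rightarrow> 'v uprod \<Rightarrow> nat \<Rightarrow> nat set" where
  "prior_sampling_times S u e t = {s \<in> {adm_time S u e t..<t}. sampling_time S u s}"

text \<open>
  The functions below are meaningful at sampling times \<open>t\<close> for \<open>e \<in> presample S u t\<close>; elsewhere
  their values are never used.
\<close>

function ret_prob :: "'v scheme \<Rightarrow> (nat \<Rightarrow> real) \<Rightarrow> 'v uprod \<Rightarrow> nat \<Rightarrow> real" where
  "ret_prob S u e t =
    min (if prior_sampling_times S u e t = {} then 1
         else ret_prob S u e (Max (prior_sampling_times S u e t)))
        (cur_weight S u e t / threshold S u t)"
  by pat_completeness auto
termination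
proof (relation "Wellfounded.measure (\<lambda>(S, u, e, t). t)", goal_cases)
  case (2 S u e t)
  have "finite (prior_sampling_times S u e t)"
    by (simp add: prior_sampling_times_def)
  from Max_in[OF this 2] show ?case
    by (simp add: prior_sampling_times_def)
qed simp

declare ret_prob.simps [simp del]

definition prior_prob :: "'v scheme \<Rightarrow> (nat \<Rightarrow> real) \<Rightarrow> 'v uprod \<Rightarrow> nat \<Rightarrow> real" where
  "prior_prob S u e t =
    (if prior_sampling_times S u e t = {} then 1
     else ret_prob S u e (Max (prior_sampling_times S u e t)))"

lemma ret_prob_eq:
  "ret_prob S u e t = min (prior_prob S u e t) (cur_weight S u e t / threshold S u t)"
  by (subst ret_prob.simps) (simp add: prior_prob_def)

definition cond_prob_ret :: "'v scheme \<Rightarrow> (nat \<Rightarrow> real) \<Rightarrow> 'v uprod \<Rightarrow> nat \<Rightarrow> real" where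
  "cond_prob_ret S u e t =
    (if sampling_time S u t then ret_prob S u e t / prior_prob S u e t else 1)"

primrec count_est :: "'v scheme \<Rightarrow> (nat \<Rightarrow> real) \<Rightarrow> 'v uprod \<Rightarrow> nat \<Rightarrow> real" where
  "count_est S u e 0 = 0"
| "count_est S u e (Suc n) =
    (if e \<in> sample S u (Suc n)
     then (count_est S u e n + of_bool (arrival S (Suc n) = e)) / cond_prob_ret S u e (Suc n)
     else 0)"

text \<open>The updated variance estimate, where \<open>v\<close> is the estimate at time \<open>t - 1\<close>.\<close>

definition var_step ::
  "'v scheme \<Rightarrow> (nat \<Rightarrow> real) \<Rightarrow> 'v uprod \<Rightarrow> nat \<Rightarrow> real \<Rightarrow> real" where
  "var_step S u e t v =
    (count_est S u e t)\<^sup>2 * (1 - cond_prob_ret S u e t) +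
    (if e \<in> sample S u t then v / cond_prob_ret S u e t else 0)"


section \<open>Information\<close>

text \<open>
  The variable assigned at time \<open>t\<close>. The variables take values in the half-open interval
  \<open>{0<..1}\<close>, so the value 0 says that no admission took place at time \<open>t\<close>.
\<close>

definition assigned :: "'v scheme \<Rightarrow> (nat \<Rightarrow> real) \<Rightarrow> nat \<Rightarrow> real" where
  "assigned S u t = (if admitted_at S u t then u t else 0)"

definition info :: "'a measure \<Rightarrow> 'v scheme \<Rightarrow> (nat \<Rightarrow> 'a \<Rightarrow> real) \<Rightarrow> nat \<Rightarrow> 'a measure" where
  "info M S U s = sigma (space M)
    {(\<lambda>\<omega>. assigned S (\<lambda>k. U k \<omega>) r) -` B \<inter> space M | r B. r \<in> {1..s} \<and> B \<in> sets borel}"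

text \<open>
  \<open>info_except M S U e s\<close> is the part of \<open>info M S U s\<close> that remains when the exact value of
  the variable currently held by \<open>e\<close> is deleted: all samples up to time \<open>s\<close> are known (in
  particular whether \<open>e\<close> is retained), as well as every assigned variable except the one assigned
  at the most recent admission of \<open>e\<close> if \<open>e\<close> is in the sample at time \<open>s\<close>.
\<close>

definition assigned_except ::
  "'v scheme \<Rightarrow> (nat \<Rightarrow> real) \<Rightarrow> 'v uprod \<Rightarrow> nat \<Rightarrow> nat \<Rightarrow> real" where
  "assigned_except S u e s r =
    (if e \<in> sample S u s \<and> r = adm_time S u e s then 0 else assigned S u r)"

definition info_except ::
  "'a measure \<Rightarrow> 'v scheme \<Rightarrow> (nat \<Rightarrow> 'a \<Rightarrow> real) \<Rightarrow> 'v uprod \<Rightarrow> nat \<Rightarrow> 'a measure" where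
  "info_except M S U e s = sigma (space M)
    ({{\<omega> \<in> space M. sample S (\<lambda>k. U k \<omega>) r = A} | r A. r \<le> s} \<union>
     {(\<lambda>\<omega>. assigned_except S (\<lambda>k. U k \<omega>) e s r) -` B \<inter> space M | r B.
        r \<in> {1..s} \<and> B \<in> sets borel})"

text \<open>
  A quantity stored with \<open>e\<close> while \<open>e\<close> is in the sample, as \<open>count_est\<close> is: it is 0 if \<open>e\<close> is not
  in the sample, and it uses the variable held by \<open>e\<close> only through the fact that \<open>e\<close> is retained.
  Unbiasedness is not preserved by the variance recursion without this condition. With capacity 2,
  unit weights and three distinct arrivals e, f, g, the count estimate of e at time 2 has variance 0.
  The estimator \<open>U 1 - 1/2\<close> of this variance is measurable with respect to \<open>info\<close> and has mean 0,
  but the recursion turns it into an estimator at time 3 of mean 5/6, while the variance is 1.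
\<close>

definition stored_with ::
  "'a measure \<Rightarrow> 'v scheme \<Rightarrow> (nat \<Rightarrow> 'a \<Rightarrow> real) \<Rightarrow> 'v uprod \<Rightarrow> nat \<Rightarrow> ('a \<Rightarrow> real) \<Rightarrow> bool" where
  "stored_with M S U e s X \<longleftrightarrow>
    X \<in> borel_measurable (info_except M S U e s) \<and>
    (\<forall>\<omega>\<in>space M. e \<notin> sample S (\<lambda>k. U k \<omega>) s \<longrightarrow> X \<omega> = 0)"


section \<open>Expectation and variance in the extended sense\<close>

text \<open>
  With capacity 1 the count estimate can have infinite variance, where the Bochner integral would
  return 0. Hence the variance is taken in \<open>[0, \<infinity>]\<close>, and a real random variable \<open>X\<close> has
  expectation \<open>c\<close> in \<open>[0, \<infinity>]\<close> if its negative part has finite integral and the difference of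
  the integrals of its positive and its negative part is \<open>c\<close>.
\<close>

definition ext_variance :: "'a measure \<Rightarrow> ('a \<Rightarrow> real) \<Rightarrow> ennreal" where
  "ext_variance M X = (\<integral>\<^sup>+ \<omega>. ennreal ((X \<omega> - (\<integral>\<eta>. X \<eta> \<partial>M))\<^sup>2) \<partial>M)"

definition has_ext_expectation :: "'a measure \<Rightarrow> ('a \<Rightarrow> real) \<Rightarrow> ennreal \<Rightarrow> bool" where
  "has_ext_expectation M X c \<longleftrightarrow>
    (\<integral>\<^sup>+ \<omega>. ennreal (- X \<omega>) \<partial>M) < \<infinity> \<and>
    (\<integral>\<^sup>+ \<omega>. ennreal (X \<omega>) \<partial>M) = c + (\<integral>\<^sup>+ \<omega>. ennreal (- X \<omega>) \<partial>M)"

lemma has_ext_expectation_ennreal_iff: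
  assumes [measurable]: "X \<in> borel_measurable M" and c: "0 \<le> c"
  shows "has_ext_expectation M X (ennreal c) \<longleftrightarrow> integrable M X \<and> (\<integral>\<omega>. X \<omega> \<partial>M) = c"
proof -
  define p where "p = (\<integral>\<^sup>+ \<omega>. ennreal (X \<omega>) \<partial>M)"
  define n where "n = (\<integral>\<^sup>+ \<omega>. ennreal (- X \<omega>) \<partial>M)"
  have int: "integrable M X \<longleftrightarrow> p < \<infinity> \<and> n < \<infinity>"
    by (auto simp: real_integrable_def p_def n_def less_top)
  show ?thesis
  proof (cases "p < \<infinity> \<and> n < \<infinity>")
    case True
    then obtain p' n' where p': "p = ennreal p'" "0 \<le> p'" and n': "n = ennreal n'" "0 \<le> n'"
      by (cases p; cases n) auto
    have "(\<integral>\<omega>. X \<omega> \<partial>M) = p' - n'"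
      using real_lebesgue_integral_def[of M X] int True p' n' by (simp add: p_def n_def)
    moreover have "p = ennreal c + n \<longleftrightarrow> p' - n' = c"
      using p' n' c by (auto simp flip: ennreal_plus)
    ultimately show ?thesis
      using int True by (simp add: has_ext_expectation_def p_def n_def)
  next
    case False
    then have "\<not> integrable M X" using int by simp
    moreover have "\<not> (n < \<infinity> \<and> p = ennreal c + n)"
      using False by (auto simp: less_top)
    ultimately show ?thesis by (simp add: has_ext_expectation_def p_def n_def)
  qed
qed

lemma (in prob_space) ext_variance_eq:
  assumes "integrable M X" "integrable M (\<lambda>\<omega>. (X \<omega>)\<^sup>2)"
  shows "ext_variance M X = ennreal (variance X)"
proof -
  have "integrable M (\<lambda>\<omega>. (X \<omega> - expectation X)\<^sup>2)"
    using assms by (simp add: power2_diff)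
  then show ?thesis
    unfolding ext_variance_def by (intro nn_integral_eq_integral) auto
qed

lemma (in prob_space) has_ext_expectation_ext_variance_iff:
  assumes "V \<in> borel_measurable M" "integrable M X" "integrable M (\<lambda>\<omega>. (X \<omega>)\<^sup>2)"
  shows "has_ext_expectation M V (ext_variance M X) \<longleftrightarrow>
    integrable M V \<and> expectation V = variance X"
  using assms by (simp add: ext_variance_eq has_ext_expectation_ennreal_iff)

end

theory Submission
  imports Defs
begin

text \<open>
  Fix the variables other than the one held by \<open>e\<close>. The threshold seen by a retained \<open>e\<close> is the
  minimal priority of the other edges, so up to ties, which form a null set, \<open>e\<close> survives until
  time \<open>t\<close> iff its variable lies below \<open>prior_prob S u e t\<close>, and as long as it survives neither the
  samples nor the stored quantities depend on the value of this variable. Integrating it out first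
  gives, for \<open>X\<close> measurable with respect to \<open>info_except\<close> at time \<open>t - 1\<close>, the identity
  \<open>E[1[e \<in> sample] X / q] = E[1[e \<in> presample] X]\<close> at time \<open>t\<close>. Put \<open>x\<close> for the count estimate at
  time \<open>t - 1\<close> plus the new count, so that the count estimate at time \<open>t\<close> is
  \<open>C = 1[e \<in> sample] x / q\<close>. The identity for \<open>x\<close>, \<open>x\<^sup>2\<close> and \<open>V\<close> yields \<open>E[C] = E[x]\<close>,
  \<open>E[C\<^sup>2] = E[C\<^sup>2 (1 - q)] + E[x\<^sup>2]\<close> and \<open>E[1[e \<in> sample] V / q] = E[V] = Var(x)\<close>, and the theorem
  follows by subtracting \<open>E[x]\<^sup>2\<close>, which is finite even if the variances are not.
\<close>

section \<open>Dependence of the sample on the variables\<close>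

text \<open>The variable held by \<open>e\<close> sits at a random index, its last admission time,
  so there is no fixed coordinate to integrate out. The events \<open>alive S e a t\<close> fix this
  index: for each deterministic \<open>a\<close> coordinate \<open>a\<close> is integrated
  innermost, and the resulting identities are summed over \<open>a\<close>. Changing a single
  coordinate makes sense on the product of uniform laws but not on an abstract probability space;
  hence quantities on \<open>M\<close> are first written as functions of the path of the variables.
  On the product, measurability with respect to \<open>info_except\<close> forces a function to take
  equal values at points that no generator separates, which makes it constant in the resampled
  coordinate. With the other coordinates frozen, \<open>e\<close> is present before the discard with
  probability \<pi> and after it with probability p = q \<pi>, so the factor 1 / q compensates
  exactly. The identities are proved in [0, \<infinity>] because 1 / q can be unbounded, for
  instance with capacity 1; a signed \<open>V\<close> enters through its positive and negative
  parts.\<close>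

lemma arg_min_on_cong:
  assumes "\<And>x. x \<in> A \<Longrightarrow> f x = g x"
  shows "arg_min_on f A = arg_min_on g A"
proof -
  have "is_arg_min f (\<lambda>x. x \<in> A) = is_arg_min g (\<lambda>x. x \<in> A)"
    using assms by (auto simp: is_arg_min_def fun_eq_iff)
  then show ?thesis by (simp add: arg_min_on_def arg_min_def)
qed

lemma sample_Suc_subset: "sample S u (Suc n) \<subseteq> presample S u (Suc n)"
  by (auto simp: sample_Suc presample_def)

lemma sample_subset_presample: "1 \<le> t \<Longrightarrow> sample S u t \<subseteq> presample S u t"
  using sample_Suc_subset[of S u "t - 1"] by simp

lemma finite_sample: "finite (sample S u n)"
proof (induction n)
  case (Suc n)
  then show ?case
    by (intro finite_subset[OF sample_Suc_subset]) (simp add: presample_def)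
qed (simp add: sample_0)

lemma finite_presample: "finite (presample S u t)"
  by (simp add: presample_def finite_sample)

text \<open>Since \<open>arrival\<close> at the admission time returns the edge, distinct members of
  the presample have distinct admission times and so hold distinct variables.\<close>

lemma adm_time_presample:
  assumes "i \<in> presample S u t" "1 \<le> t"
  shows "adm_time S u i t \<in> {1..t} \<and> admitted_at S u (adm_time S u i t) \<and>
    arrival S (adm_time S u i t) = i"
  using assms(2,1)
proof (induction t rule: nat_induct_at_least)
  case base
  then show ?case
    by (auto simp: presample_def sample_0 adm_time_Suc[of _ _ _ 0, simplified] admitted_at_def)
next
  case (Suc n)
  show ?case
  proof (cases "admitted_at S u (Suc n) \<and> arrival S (Suc n) = i")
    case True
    then show ?thesis by (simp add: adm_time_Suc)
  next
    case False
    then have "i \<in> sample S u n"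
      using Suc.prems by (auto simp: presample_def admitted_at_def)
    with Suc.hyps have "i \<in> presample S u n"
      using sample_subset_presample by blast
    with Suc.IH False show ?thesis by (auto simp: adm_time_Suc)
  qed
qed

lemma adm_time_sample:
  assumes "i \<in> sample S u n"
  shows "adm_time S u i n \<in> {1..n} \<and> admitted_at S u (adm_time S u i n) \<and>
    arrival S (adm_time S u i n) = i"
proof -
  have "1 \<le> n"
    using assms by (cases n) (auto simp: sample_0)
  with assms show ?thesis
    using adm_time_presample sample_subset_presample by blast
qed

lemma adm_time_le: "adm_time S u i n \<le> n"
proof (induction n)
  case (Suc n)
  then show ?case by (auto simp: adm_time_Suc)
qed (simp add: adm_time_def)

lemma adm_time_Suc_sample:
  "e \<in> sample S u n \<Longrightarrow> adm_time S u e (Suc n) = adm_time S u e n"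
  by (auto simp: adm_time_Suc admitted_at_def)

lemma state_eqI:
  "sample S u n = sample S v n \<Longrightarrow> (\<And>i. adm_time S u i n = adm_time S v i n) \<Longrightarrow>
    state S u n = state S v n"
  by (simp add: sample_def adm_time_def prod_eq_iff fun_eq_iff)

lemma adm_time_Suc_cong:
  "state S u n = state S v n \<Longrightarrow> adm_time S u i (Suc n) = adm_time S v i (Suc n)"
  by (auto simp: adm_time_def sample_def Let_def)

lemma presample_Suc_cong:
  "state S u n = state S v n \<Longrightarrow> presample S u (Suc n) = presample S v (Suc n)"
  by (simp add: presample_def sample_def)

lemma sampling_time_Suc_cong:
  "state S u n = state S v n \<Longrightarrow> sampling_time S u (Suc n) = sampling_time S v (Suc n)"
  by (simp add: sampling_time_def presample_def admitted_at_def sample_def)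

text \<open>The branch in which the arriving edge is already sampled is absorbed by the branch
  without discard, because inserting it changes nothing. Later inductions then distinguish only
  sampling times from other times.\<close>

lemma sample_Suc_sampling:
  "sample S u (Suc n) =
    (if sampling_time S u (Suc n) then presample S u (Suc n)
       - {arg_min_on (\<lambda>i. priority S u i (Suc n)) (presample S u (Suc n))}
     else presample S u (Suc n))"
  by (auto simp: sample_Suc sampling_time_def admitted_at_def presample_def insert_absorb)

text \<open>Priorities read variables only at the admission times of current competitors, and these
  times are positive and not later than the present.\<close>

lemma state_cong:
  assumes "\<And>k. k \<in> {1..n} \<Longrightarrow> u k = v k"
  shows "state S u n = state S v n"
  using assms
proof (induction n)
  case (Suc n)
  then have eq: "state S u n = state S v n" by simp
  have "priority S u i (Suc n) = priority S v i (Suc n)" if "i \<in> presample S u (Suc n)" for i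
    using adm_time_presample[OF that] Suc.prems adm_time_Suc_cong[OF eq, of i]
    by (simp add: priority_def cur_weight_def)
  then have "arg_min_on (\<lambda>i. priority S u i (Suc n)) (presample S u (Suc n)) =
    arg_min_on (\<lambda>i. priority S v i (Suc n)) (presample S u (Suc n))"
    by (rule arg_min_on_cong)
  then show ?case
    by (intro state_eqI adm_time_Suc_cong[OF eq])
      (simp_all add: sample_Suc_sampling sampling_time_Suc_cong[OF eq] presample_Suc_cong[OF eq])
qed simp

text \<open>Leaving out \<open>e\<close> frees the minimum from the variable that \<open>e\<close>
  holds, on which \<open>threshold\<close> formally depends. At sampling times the minimum is over a
  nonempty set by \<open>others_nonempty\<close>.\<close>

definition other_threshold :: "'v scheme \<Rightarrow> (nat \<Rightarrow> real) \<Rightarrow> 'v uprod \<Rightarrow> nat \<Rightarrow> real" where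
  "other_threshold S u e t = Min ((\<lambda>i. priority S u i t) ` (presample S u t - {e}))"

lemma arg_min_on_finite:
  fixes f :: "'b \<Rightarrow> real"
  assumes "finite A" "A \<noteq> {}"
  shows "arg_min_on f A \<in> A" "x \<in> A \<Longrightarrow> f (arg_min_on f A) \<le> f x"
  using arg_min_if_finite[OF assms, of f] arg_min_least[OF assms, of x f] by auto

lemma sampling_timeD: "sampling_time S u t \<Longrightarrow> 1 \<le> t"
  by (simp add: sampling_time_def admitted_at_def)

lemma sample_sampling_time:
  assumes "sampling_time S u t"
  shows "sample S u t = presample S u t - {arg_min_on (\<lambda>i. priority S u i t) (presample S u t)}"
  using assms sampling_timeD[OF assms] sample_Suc_sampling[of S u "t - 1"] by simp

lemma sample_not_sampling_time:
  "\<not> sampling_time S u t \<Longrightarrow> 1 \<le> t \<Longrightarrow> sample S u t = presample S u t"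
  using sample_Suc_sampling[of S u "t - 1"] by simp

lemma presample_nonempty: "presample S u t \<noteq> {}"
  by (simp add: presample_def)

text \<open>The discarded edge attains the minimum and differs from the retained \<open>e\<close>,
  so it attains the minimum over the others as well.\<close>

lemma threshold_eq_other_threshold:
  assumes "sampling_time S u t" "e \<in> sample S u t"
  shows "threshold S u t = other_threshold S u e t"
proof -
  let ?f = "\<lambda>i. priority S u i t"
  define d where "d = arg_min_on ?f (presample S u t)"
  have d: "d \<in> presample S u t - {e}" "\<And>i. i \<in> presample S u t \<Longrightarrow> ?f d \<le> ?f i"
    using assms arg_min_on_finite[OF finite_presample[of S u t] presample_nonempty, where f="?f"]
    by (auto simp: sample_sampling_time d_def)
  have "threshold S u t = ?f d" "other_threshold S u e t = ?f d"
    using d finite_presample[of S u t]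
    by (auto simp: threshold_def other_threshold_def intro!: Min_eqI)
  then show ?thesis by simp
qed

text \<open>Turns the recursion through the last sampling time into a one-step recursion, on which
  the later inductions over time rest. A sampled edge keeps its admission time, so the window of
  earlier sampling times can only gain \<open>n\<close>.\<close>

lemma prior_prob_Suc:
  assumes "e \<in> sample S u n"
  shows "prior_prob S u e (Suc n) =
    (if sampling_time S u n then ret_prob S u e n else prior_prob S u e n)"
proof -
  have eq: "prior_sampling_times S u e (Suc n) =
    (if sampling_time S u n then insert n (prior_sampling_times S u e n)
     else prior_sampling_times S u e n)"
    using adm_time_Suc_sample[OF assms] adm_time_le[of S u e n]
    by (auto simp: prior_sampling_times_def less_Suc_eq)
  show ?thesis
  proof (cases "sampling_time S u n")
    case True
    have "Max (insert n (prior_sampling_times S u e n)) = n"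
      by (intro Max_eqI) (auto simp: prior_sampling_times_def)
    with True eq show ?thesis by (simp add: prior_prob_def)
  qed (simp add: prior_prob_def eq)
qed

lemma prior_prob_new: "adm_time S u e t = t \<Longrightarrow> prior_prob S u e t = 1"
  by (simp add: prior_prob_def prior_sampling_times_def)

lemma ret_prob_retained:
  assumes "sampling_time S u t" "e \<in> sample S u t"
  shows "ret_prob S u e t = min (prior_prob S u e t) (cur_weight S u e t / other_threshold S u e t)"
  using threshold_eq_other_threshold[OF assms] by (simp add: ret_prob_eq)

lemma count_est_eq_0: "e \<notin> sample S u n \<Longrightarrow> count_est S u e n = 0"
  by (cases n) (auto simp: sample_0)

text \<open>The index \<open>a\<close> is deterministic, so the coordinate to be resampled is fixed
  on this event. The event refers to the situation before the discard at time \<open>t\<close>; as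
  \<open>a\<close> varies, these events partition \<open>e \<in> presample S u t\<close>.\<close>

definition alive :: "'v scheme \<Rightarrow> 'v uprod \<Rightarrow> nat \<Rightarrow> nat \<Rightarrow> (nat \<Rightarrow> real) \<Rightarrow> bool" where
  "alive S e a t u \<longleftrightarrow> e \<in> presample S u t \<and> adm_time S u e t = a"

text \<open>A new admission of \<open>e\<close> at the next time would move its admission time
  beyond \<open>a\<close>, because \<open>a \<le> t\<close>. Hence survival in the sample is the
  only way to stay alive.\<close>

lemma alive_Suc:
  assumes "1 \<le> a" "a \<le> t"
  shows "alive S e a (Suc t) u \<longleftrightarrow> alive S e a t u \<and> e \<in> sample S u t"
proof
  assume "alive S e a (Suc t) u"
  then have *: "e \<in> presample S u (Suc t)" "adm_time S u e (Suc t) = a" by (auto simp: alive_def)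
  have nadm: "\<not> (admitted_at S u (Suc t) \<and> arrival S (Suc t) = e)"
    using * assms by (auto simp: adm_time_Suc)
  then have "e \<in> sample S u t" "adm_time S u e t = a"
    using * by (auto simp: presample_def admitted_at_def adm_time_Suc split: if_splits)
  then show "alive S e a t u \<and> e \<in> sample S u t"
    using sample_subset_presample[of t S u] assms by (auto simp: alive_def)
next
  assume "alive S e a t u \<and> e \<in> sample S u t"
  then show "alive S e a (Suc t) u"
    using adm_time_Suc_sample[of e S u t] by (simp add: alive_def presample_def)
qed

section \<open>Consequences of positive weights and positive variables\<close>

locale reservoir =
  fixes S :: "'v scheme" and E :: "'v uprod set" and T :: nat
  assumes finite_E: "finite E"
    and arrival_E: "\<And>s. s \<in> {1..T} \<Longrightarrow> arrival S s \<in> E"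
    and capacity: "1 \<le> capacity S"
    and weight_pos: "\<And>i a s. i \<in> E \<Longrightarrow> 1 \<le> a \<Longrightarrow> a \<le> s \<Longrightarrow> s \<le> T \<Longrightarrow> 0 < weight S i a s"
begin

lemma presample_E:
  assumes "t \<in> {1..T}"
  shows "presample S u t \<subseteq> E"
proof
  fix i assume "i \<in> presample S u t"
  from adm_time_presample[OF this] assms arrival_E[of "adm_time S u i t"] show "i \<in> E" by auto
qed

lemma sample_E:
  assumes "n \<le> T"
  shows "sample S u n \<subseteq> E"
proof
  fix i assume "i \<in> sample S u n"
  from adm_time_sample[OF this] assms arrival_E[of "adm_time S u i n"] show "i \<in> E" by auto
qed

text \<open>With capacity at least 1, an overflowing presample has at least two elements.\<close>

lemma others_nonempty:
  assumes "sampling_time S u t"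
  shows "presample S u t - {e} \<noteq> {}"
proof
  assume "presample S u t - {e} = {}"
  then have "card (presample S u t) \<le> card {e}"
    by (intro card_mono) auto
  with assms capacity show False by (simp add: sampling_time_def)
qed

lemma cur_weight_pos:
  assumes "i \<in> presample S u t" "t \<in> {1..T}"
  shows "0 < cur_weight S u i t"
  using adm_time_presample[OF assms(1)] assms presample_E[OF assms(2)]
  by (auto simp: cur_weight_def intro!: weight_pos)

lemma priority_pos:
  assumes "\<And>k. k \<in> {1..T} \<Longrightarrow> 0 < u k" "i \<in> presample S u t" "t \<in> {1..T}"
  shows "0 < priority S u i t"
  using adm_time_presample[OF assms(2)] assms(3) cur_weight_pos[OF assms(2,3)]
  by (auto simp: priority_def intro!: divide_pos_pos assms(1))

lemma threshold_pos:
  assumes "\<And>k. k \<in> {1..T} \<Longrightarrow> 0 < u k" "t \<in> {1..T}"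
  shows "0 < threshold S u t"
proof -
  have "\<forall>i\<in>presample S u t. 0 < priority S u i t"
    using priority_pos[of u, OF assms(1) _ assms(2)] by blast
  then show ?thesis
    using finite_presample[of S u t] presample_nonempty[of S u t]
    by (simp add: threshold_def Min_gr_iff)
qed

text \<open>A new admission starts at 1, and each sampling time takes the minimum with a positive
  ratio. Positivity justifies the later divisions by these probabilities.\<close>

lemma prior_prob_bounds:
  assumes u: "\<And>k. k \<in> {1..T} \<Longrightarrow> 0 < u k" and "e \<in> presample S u t" "t \<in> {1..T}"
  shows "0 < prior_prob S u e t \<and> prior_prob S u e t \<le> 1"
proof -
  have "1 \<le> t" using assms by simp
  then show ?thesis
    using assms(2,3)
  proof (induction t rule: nat_induct_at_least)
    case base
    then have "adm_time S u e 1 = 1"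
      using adm_time_presample[of e S u 1] by auto
    then show ?case by (simp add: prior_prob_new)
  next
    case (Suc n)
    show ?case
    proof (cases "e \<in> sample S u n")
      case True
      then have e: "e \<in> presample S u n"
        using sample_subset_presample Suc.hyps by blast
      have "0 < cur_weight S u e n / threshold S u n"
        using Suc.hyps Suc.prems by (intro divide_pos_pos cur_weight_pos e threshold_pos u) auto
      then show ?thesis
        using Suc.IH[OF e] Suc.hyps Suc.prems by (auto simp: prior_prob_Suc True ret_prob_eq)
    next
      case False
      then have "adm_time S u e (Suc n) = Suc n"
        using Suc.prems(1) by (auto simp: adm_time_Suc presample_def admitted_at_def)
      then show ?thesis by (simp add: prior_prob_new)
    qed
  qed
qed

lemma cond_prob_ret_bounds:
  assumes u: "\<And>k. k \<in> {1..T} \<Longrightarrow> 0 < u k" and "e \<in> presample S u t" "t \<in> {1..T}"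
  shows "0 < cond_prob_ret S u e t \<and> cond_prob_ret S u e t \<le> 1"
proof -
  have "0 < cur_weight S u e t / threshold S u t"
    using assms by (intro divide_pos_pos cur_weight_pos threshold_pos u) auto
  then show ?thesis
    using prior_prob_bounds[OF assms]
    by (auto simp: cond_prob_ret_def ret_prob_eq)
qed

lemma count_est_nonneg:
  assumes u: "\<And>k. k \<in> {1..T} \<Longrightarrow> 0 < u k" and "n \<le> T"
  shows "0 \<le> count_est S u e n"
  using assms(2)
proof (induction n)
  case (Suc n)
  have "0 < cond_prob_ret S u e (Suc n)" if "e \<in> sample S u (Suc n)"
    using cond_prob_ret_bounds[of u e "Suc n", OF u] that sample_Suc_subset[of S u n] Suc.prems by auto
  with Suc show ?case by auto
qed simp

text \<open>
  Outside a null set the variables lie strictly between 0 and 1 and there are no ties between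
  priorities. Ties matter because \<open>arg_min_on\<close> resolves them by \<open>SOME\<close>.
\<close>

definition generic :: "(nat \<Rightarrow> real) \<Rightarrow> bool" where
  "generic u \<longleftrightarrow> (\<forall>k\<in>{1..T}. 0 < u k \<and> u k < 1) \<and>
    (\<forall>i\<in>E. \<forall>j\<in>E. \<forall>b\<in>{1..T}. \<forall>c\<in>{1..T}. \<forall>s\<in>{1..T}. b \<noteq> c \<longrightarrow> b \<le> s \<longrightarrow> c \<le> s \<longrightarrow>
      weight S i b s / u b \<noteq> weight S j c s / u c)"

lemma generic_pos: "generic u \<Longrightarrow> k \<in> {1..T} \<Longrightarrow> 0 < u k"
  by (simp add: generic_def)

lemma inj_on_priority:
  assumes "generic u" "t \<in> {1..T}"
  shows "inj_on (\<lambda>i. priority S u i t) (presample S u t)"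
proof (rule inj_onI, rule ccontr)
  fix i j
  assume ij: "i \<in> presample S u t" "j \<in> presample S u t" "priority S u i t = priority S u j t"
    and "i \<noteq> j"
  have "adm_time S u i t \<in> {1..t}" "adm_time S u j t \<in> {1..t}"
    "adm_time S u i t \<noteq> adm_time S u j t" "i \<in> E" "j \<in> E"
    using adm_time_presample[of i S u t] adm_time_presample[of j S u t] ij \<open>i \<noteq> j\<close> assms(2)
      presample_E[OF assms(2), of u] by auto
  with assms ij(3) show False
    by (auto simp: generic_def priority_def cur_weight_def)
qed

text \<open>Without ties \<open>e\<close> escapes the discard iff its priority exceeds the minimum
  over the others; solving for the variable held by \<open>e\<close> gives a bound that does not
  involve this variable.\<close>

lemma retained_iff:
  assumes "generic u" "sampling_time S u t" "t \<le> T" "e \<in> presample S u t"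
  shows "e \<in> sample S u t \<longleftrightarrow>
    u (adm_time S u e t) < cur_weight S u e t / other_threshold S u e t"
proof -
  let ?f = "\<lambda>i. priority S u i t" and ?K = "presample S u t"
  have t: "t \<in> {1..T}" using assms sampling_timeD by auto
  have inj: "inj_on ?f ?K" by (rule inj_on_priority[OF assms(1) t])
  define d where "d = arg_min_on ?f ?K"
  have d: "d \<in> ?K" "\<And>i. i \<in> ?K \<Longrightarrow> ?f d \<le> ?f i"
    using arg_min_on_finite[OF finite_presample[of S u t] presample_nonempty, where f="?f"]
    by (auto simp: d_def)
  have z: "0 < other_threshold S u e t"
    using priority_pos[of u, OF generic_pos[OF assms(1)] _ t] finite_presample[of S u t]
      others_nonempty[OF assms(2), of e]
    by (simp add: other_threshold_def Min_gr_iff)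
  have ue: "0 < u (adm_time S u e t)"
    using adm_time_presample[OF assms(4)] t by (intro generic_pos[OF assms(1)]) auto
  have "e \<in> sample S u t \<longleftrightarrow> e \<noteq> d"
    using assms by (auto simp: sample_sampling_time d_def)
  also have "\<dots> \<longleftrightarrow> other_threshold S u e t < ?f e"
  proof
    assume "e \<noteq> d"
    then have "?f d \<noteq> ?f e" using inj d(1) assms(4) by (auto dest: inj_onD)
    with d(2)[OF assms(4)] have "?f d < ?f e" by simp
    moreover have "other_threshold S u e t \<le> ?f d"
      using d(1) \<open>e \<noteq> d\<close> finite_presample[of S u t]
      by (auto simp: other_threshold_def intro!: Min_le)
    ultimately show "other_threshold S u e t < ?f e" by simp
  next
    assume *: "other_threshold S u e t < ?f e"
    have "other_threshold S u e t \<in> ?f ` (?K - {e})"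
      unfolding other_threshold_def
      using others_nonempty[OF assms(2), of e] finite_presample[of S u t] by (intro Min_in) auto
    with * d(2) show "e \<noteq> d" by force
  qed
  also have "\<dots> \<longleftrightarrow> u (adm_time S u e t) < cur_weight S u e t / other_threshold S u e t"
    using z ue by (simp add: priority_def field_simps)
  finally show ?thesis .
qed

text \<open>Describes the discarded edge without the variable of \<open>e\<close>. Leaving out an
  edge that is not minimal keeps the minimum, and the absence of ties forces both choices made by
  \<open>arg_min_on\<close> to be the same edge.\<close>

lemma sample_retained:
  assumes "generic u" "sampling_time S u t" "t \<le> T" "e \<in> sample S u t"
  shows "sample S u t =
    presample S u t - {arg_min_on (\<lambda>i. priority S u i t) (presample S u t - {e})}"
proof -
  let ?f = "\<lambda>i. priority S u i t" and ?K = "presample S u t"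
  have t: "t \<in> {1..T}" using assms sampling_timeD by auto
  define d d' where "d = arg_min_on ?f ?K" and "d' = arg_min_on ?f (?K - {e})"
  have d: "d \<in> ?K" "\<And>i. i \<in> ?K \<Longrightarrow> ?f d \<le> ?f i"
    using arg_min_on_finite[OF finite_presample[of S u t] presample_nonempty, where f="?f"]
    by (auto simp: d_def)
  have d': "d' \<in> ?K - {e}" "\<And>i. i \<in> ?K - {e} \<Longrightarrow> ?f d' \<le> ?f i"
    using arg_min_on_finite[OF _ others_nonempty[OF assms(2), of e], where f="?f"] finite_presample
    by (auto simp: d'_def)
  have "d \<noteq> e" using assms by (auto simp: sample_sampling_time d_def)
  then have "?f d = ?f d'" using d d' by (intro antisym) auto
  then have "d = d'" using inj_on_priority[OF assms(1) t] d d' by (auto dest: inj_onD)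
  then show ?thesis using assms by (simp add: sample_sampling_time d_def d'_def)
qed

section \<open>Effect of changing only the variable held by \<open>e\<close>\<close>

lemma same_past:
  assumes u': "\<And>k. k \<noteq> a \<Longrightarrow> u' k = u k"
    and t: "t \<in> {1..T}"
    and al: "alive S e a t u" "alive S e a t u'"
    and st: "state S u (t - 1) = state S u' (t - 1)"
  shows "presample S u' t = presample S u t" "adm_time S u' i t = adm_time S u i t"
    "sampling_time S u' t = sampling_time S u t" "cur_weight S u' i t = cur_weight S u i t"
    "i \<in> presample S u t - {e} \<Longrightarrow> priority S u' i t = priority S u i t"
    "other_threshold S u' e t = other_threshold S u e t"
proof -
  show p: "presample S u' t = presample S u t" and a: "adm_time S u' i t = adm_time S u i t"
    and "sampling_time S u' t = sampling_time S u t" for i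
    using presample_Suc_cong[OF st] adm_time_Suc_cong[OF st] sampling_time_Suc_cong[OF st] t
    by auto
  show w: "cur_weight S u' i t = cur_weight S u i t" for i
    by (simp add: cur_weight_def a)
  show pr: "priority S u' i t = priority S u i t" if "i \<in> presample S u t - {e}" for i
  proof -
    have "adm_time S u i t \<noteq> a"
      using adm_time_presample[of i S u t] adm_time_presample[of e S u t] that al(1) t
      by (auto simp: alive_def)
    then show ?thesis by (simp add: priority_def w a u')
  qed
  show "other_threshold S u' e t = other_threshold S u e t"
    unfolding other_threshold_def p using pr by (intro arg_cong[where f=Min] image_cong) auto
qed

text \<open>By \<open>sample_retained\<close> the discarded edge is determined by the priorities of
  the other edges, which ignore coordinate \<open>a\<close>. Retention is assumed in both runs,
  since otherwise one of them would discard \<open>e\<close> itself.\<close>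

lemma same_past_retained:
  assumes u': "\<And>k. k \<noteq> a \<Longrightarrow> u' k = u k"
    and gen: "generic u" "generic u'" and t: "t \<in> {1..T}"
    and al: "alive S e a t u" "alive S e a t u'"
    and st: "state S u (t - 1) = state S u' (t - 1)"
    and ret: "e \<in> sample S u t" "e \<in> sample S u' t"
  shows "state S u t = state S u' t"
proof (rule state_eqI)
  note same = same_past[OF u' t al st]
  show "adm_time S u i t = adm_time S u' i t" for i by (simp add: same)
  show "sample S u t = sample S u' t"
  proof (cases "sampling_time S u t")
    case True
    have "arg_min_on (\<lambda>i. priority S u i t) (presample S u t - {e}) =
      arg_min_on (\<lambda>i. priority S u' i t) (presample S u t - {e})"
      using same by (intro arg_min_on_cong) simp
    then show ?thesis
      using sample_retained[OF gen(1) True _ ret(1)] sample_retained[OF gen(2) _ _ ret(2)] True t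
      by (simp add: same)
  next
    case False
    then show ?thesis using t by (simp add: sample_not_sampling_time same)
  qed
qed

text \<open>The run with \<open>u\<close> serves as reference: the bound
  \<open>prior_prob S u e t\<close> comes from it and stays constant when \<open>u' a\<close>
  varies. Survival and agreement of the runs are proved together, because the cutoff met by
  \<open>u'\<close> is known to be that of \<open>u\<close> as long as the pasts agree, and
  agreement of the pasts is propagated as long as \<open>e\<close> survives in both.\<close>

lemma alive_resample:
  assumes u': "\<And>k. k \<noteq> a \<Longrightarrow> u' k = u k"
    and gen: "generic u" "generic u'" and a: "1 \<le> a" "a \<le> t" "t \<le> T"
    and al: "alive S e a t u"
  shows "(alive S e a t u' \<longleftrightarrow> u' a < prior_prob S u e t) \<and>
    (alive S e a t u' \<longrightarrow> (\<forall>r<t. state S u r = state S u' r) \<and>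
      prior_prob S u' e t = prior_prob S u e t)"
  using a(2,3) al
proof (induction t rule: nat_induct_at_least)
  case base
  have st: "state S u r = state S u' r" if "r < a" for r
    using that by (intro state_cong) (simp add: u')
  then have st': "state S u (a - 1) = state S u' (a - 1)" using a by simp
  have "alive S e a a u'"
    using base presample_Suc_cong[OF st'] adm_time_Suc_cong[OF st', of e] a by (simp add: alive_def)
  \<comment> \<open>At the admission time the bound is 1, so the claim is \<open>u' a < 1\<close>,
    which is part of \<open>generic u'\<close>.\<close>
  then show ?case
    using base gen a st by (auto simp: alive_def prior_prob_new generic_def)
next
  case (Suc t)
  have t: "t \<in> {1..T}" using Suc a by auto
  have al: "alive S e a t u" and ret: "e \<in> sample S u t"
    using Suc.prems alive_Suc a Suc.hyps by blast+
  note IH = Suc.IH[OF _ al]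
  show ?case
  proof (cases "alive S e a t u'")
    case False
    \<comment> \<open>A value that has failed the bound fails it for ever, because the bound can
      only decrease.\<close>
    then have "\<not> u' a < prior_prob S u e t" using IH t by auto
    moreover have "prior_prob S u e (Suc t) \<le> prior_prob S u e t"
      by (auto simp: prior_prob_Suc[OF ret] ret_prob_eq)
    moreover have "\<not> alive S e a (Suc t) u'" using False alive_Suc a Suc.hyps by blast
    ultimately show ?thesis by auto
  next
    case True
    have st: "state S u r = state S u' r" if "r < t" for r
      using IH True t that by auto
    have st': "state S u (t - 1) = state S u' (t - 1)" using t by (intro st) auto
    have lt: "u' a < prior_prob S u e t" and pp: "prior_prob S u' e t = prior_prob S u e t"
      using IH True t by auto
    note same = same_past[OF u' t al True st']
    have tail: "(\<forall>r<Suc t. state S u r = state S u' r) \<and>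
      prior_prob S u' e (Suc t) = prior_prob S u e (Suc t)" if ret': "e \<in> sample S u' t"
    proof
      have "state S u t = state S u' t"
        by (rule same_past_retained[OF u' gen t al True st' ret ret'])
      with st show "\<forall>r<Suc t. state S u r = state S u' r" by (auto simp: less_Suc_eq)
      show "prior_prob S u' e (Suc t) = prior_prob S u e (Suc t)"
        using ret_prob_retained[of S u t e] ret_prob_retained[of S u' t e] ret ret'
        by (auto simp: prior_prob_Suc pp same)
    qed
    \<comment> \<open>At a sampling time the new bound is the minimum of the old one, already met by
      \<open>lt\<close>, and the current cutoff, which is the same in both runs.\<close>
    have "e \<in> sample S u' t \<longleftrightarrow> u' a < prior_prob S u e (Suc t)"
    proof (cases "sampling_time S u t")
      case samp: True
      have "e \<in> sample S u' t \<longleftrightarrow> u' a < cur_weight S u e t / other_threshold S u e t"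
        using retained_iff[OF gen(2), of t e] samp True t by (simp add: same alive_def)
      then show ?thesis
        using samp ret lt by (simp add: prior_prob_Suc ret_prob_retained)
    next
      case False
      then show ?thesis
        using lt ret True t sample_not_sampling_time[of S u' t]
        by (simp add: prior_prob_Suc same alive_def)
    qed
    moreover have "alive S e a (Suc t) u' \<longleftrightarrow> e \<in> sample S u' t"
      using True alive_Suc a Suc.hyps by blast
    ultimately show ?thesis using tail by blast
  qed
qed

end

section \<open>Measurability\<close>

lemma measurable_compose_count:
  "f \<in> N \<rightarrow>\<^sub>M count_space UNIV \<Longrightarrow> (\<lambda>\<omega>. g (f \<omega>)) \<in> N \<rightarrow>\<^sub>M count_space UNIV"
  by (rule measurable_compose[where N="count_space UNIV"]) auto

lemma measurable_if_pred:
  assumes "Measurable.pred N P" "f \<in> N \<rightarrow>\<^sub>M L" "g \<in> N \<rightarrow>\<^sub>M L"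
  shows "(\<lambda>\<omega>. if P \<omega> then f \<omega> else g \<omega>) \<in> N \<rightarrow>\<^sub>M L"
  using assms by measurable

lemma measurable_count_space_subset:
  "f \<in> N \<rightarrow>\<^sub>M count_space UNIV \<Longrightarrow> (\<And>\<omega>. \<omega> \<in> space N \<Longrightarrow> f \<omega> \<in> I) \<Longrightarrow> f \<in> N \<rightarrow>\<^sub>M count_space I"
  by (auto simp: measurable_def)

text \<open>The type of edges may be uncountable, and then measurable level sets alone do not give
  measurability into \<open>count_space UNIV\<close>; the finite range does.\<close>

lemma measurable_count_space_UNIV_I:
  assumes "finite I" "\<And>\<omega>. \<omega> \<in> space N \<Longrightarrow> f \<omega> \<in> I"
    and "\<And>a. a \<in> I \<Longrightarrow> {\<omega> \<in> space N. f \<omega> = a} \<in> sets N"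
  shows "f \<in> N \<rightarrow>\<^sub>M count_space UNIV"
proof -
  have "f -` {a} \<inter> space N = {\<omega> \<in> space N. f \<omega> = a}" for a by auto
  then have "f \<in> N \<rightarrow>\<^sub>M count_space I"
    using assms by (subst measurable_count_space_eq2) auto
  then show ?thesis
    by (rule measurable_compose[where g="\<lambda>x. x"]) auto
qed

lemma borel_measurable_Min_set:
  fixes f :: "'i \<Rightarrow> 'b \<Rightarrow> real"
  assumes "finite F" "A \<in> N \<rightarrow>\<^sub>M count_space UNIV" "\<And>\<omega>. \<omega> \<in> space N \<Longrightarrow> A \<omega> \<subseteq> F"
    and "\<And>i. i \<in> F \<Longrightarrow> f i \<in> borel_measurable N"
  shows "(\<lambda>\<omega>. Min ((\<lambda>i. f i \<omega>) ` A \<omega>)) \<in> borel_measurable N"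
proof (rule measurable_compose_countable'[where I="Pow F" and g=A])
  show "(\<lambda>\<omega>. Min ((\<lambda>i. f i \<omega>) ` B)) \<in> borel_measurable N" if "B \<in> Pow F" for B
    using that assms(1,4) by (intro borel_measurable_Min) (auto intro: finite_subset)
  show "A \<in> N \<rightarrow>\<^sub>M count_space (Pow F)"
    using assms(3) by (intro measurable_count_space_subset[OF assms(2)]) auto
qed (use assms(1) in \<open>simp add: countable_finite\<close>)

text \<open>Ties are resolved by choice, but \<open>arg_min_on\<close> depends on \<open>f\<close>
  only through the set of minimisers. This set takes finitely many values, and any function of it,
  the choice included, is measurable.\<close>

lemma measurable_arg_min_on:
  fixes f :: "'i \<Rightarrow> 'b \<Rightarrow> real"
  assumes F: "finite F" and A: "A \<in> N \<rightarrow>\<^sub>M count_space UNIV" "\<And>\<omega>. \<omega> \<in> space N \<Longrightarrow> A \<omega> \<subseteq> F"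
    and f: "\<And>i. i \<in> F \<Longrightarrow> f i \<in> borel_measurable N"
  shows "(\<lambda>\<omega>. arg_min_on (\<lambda>i. f i \<omega>) (A \<omega>)) \<in> N \<rightarrow>\<^sub>M count_space UNIV"
proof -
  define B where "B \<omega> = {x \<in> A \<omega>. \<forall>y\<in>A \<omega>. \<not> f y \<omega> < f x \<omega>}" for \<omega>
  have memA: "Measurable.pred N (\<lambda>\<omega>. x \<in> A \<omega>)" for x
    using measurable_compose_count[OF A(1), of "\<lambda>B. x \<in> B"] by simp
  have "B \<in> N \<rightarrow>\<^sub>M count_space UNIV"
  proof (rule measurable_count_space_UNIV_I)
    show "finite (Pow F)" using F by simp
    show "B \<omega> \<in> Pow F" if "\<omega> \<in> space N" for \<omega> using A(2)[OF that] by (auto simp: B_def)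
    fix b assume b: "b \<in> Pow F"
    have 1: "Measurable.pred N (\<lambda>\<omega>. f y \<omega> < f x \<omega>)" if "x \<in> F" "y \<in> F" for x y
      using f[OF that(1)] f[OF that(2)] by measurable
    have 2: "Measurable.pred N (\<lambda>\<omega>. \<forall>y\<in>F. y \<in> A \<omega> \<longrightarrow> \<not> f y \<omega> < f x \<omega>)" if "x \<in> F" for x
      using memA 1[OF that] by (intro pred_intros_finite[OF F] pred_intros_logic) auto
    have 3: "Measurable.pred N
      (\<lambda>\<omega>. \<forall>x\<in>F. x \<in> b \<longleftrightarrow> (x \<in> A \<omega> \<and> (\<forall>y\<in>F. y \<in> A \<omega> \<longrightarrow> \<not> f y \<omega> < f x \<omega>)))"
      using memA 1 by (intro pred_intros_finite[OF F] pred_intros_logic) auto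
    have "B \<omega> = b \<longleftrightarrow> (\<forall>x\<in>F. x \<in> b \<longleftrightarrow> (x \<in> A \<omega> \<and> (\<forall>y\<in>F. y \<in> A \<omega> \<longrightarrow> \<not> f y \<omega> < f x \<omega>)))"
      if "\<omega> \<in> space N" for \<omega>
      using A(2)[OF that] b unfolding B_def by blast
    then have "{\<omega> \<in> space N. B \<omega> = b} = {\<omega> \<in> space N.
      \<forall>x\<in>F. x \<in> b \<longleftrightarrow> (x \<in> A \<omega> \<and> (\<forall>y\<in>F. y \<in> A \<omega> \<longrightarrow> \<not> f y \<omega> < f x \<omega>))}"
      by blast
    with 3 show "{\<omega> \<in> space N. B \<omega> = b} \<in> sets N" by (simp add: pred_def)
  qed
  from measurable_compose_count[OF this, of "\<lambda>B. SOME x. x \<in> B"] show ?thesis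
    by (simp add: B_def arg_min_on_def arg_min_def is_arg_min_def Ball_def)
qed

text \<open>Only samples strictly before \<open>n\<close> enter, since admission at time
  \<open>n\<close> is decided by the sample at time \<open>n - 1\<close>.\<close>

lemma measurable_adm_time:
  assumes "\<And>r. r < n \<Longrightarrow> (\<lambda>\<omega>. sample S (u \<omega>) r) \<in> N \<rightarrow>\<^sub>M count_space UNIV"
  shows "(\<lambda>\<omega>. adm_time S (u \<omega>) i n) \<in> N \<rightarrow>\<^sub>M count_space UNIV"
  using assms
proof (induction n)
  case 0
  then show ?case by (simp add: adm_time_def)
next
  case (Suc n)
  have "Measurable.pred N (\<lambda>\<omega>. arrival S (Suc n) \<notin> sample S (u \<omega>) n \<and> arrival S (Suc n) = i)"
    using measurable_compose_count[OF Suc.prems[of n],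
      of "\<lambda>A. arrival S (Suc n) \<notin> A \<and> arrival S (Suc n) = i"] by simp
  moreover have "(\<lambda>\<omega>. adm_time S (u \<omega>) i n) \<in> N \<rightarrow>\<^sub>M count_space UNIV"
    using Suc by simp
  ultimately show ?case
    unfolding adm_time_Suc admitted_at_def by (simp add: measurable_If)
qed

lemma measurable_presample_Suc:
  assumes "(\<lambda>\<omega>. sample S (u \<omega>) n) \<in> N \<rightarrow>\<^sub>M count_space UNIV"
  shows "(\<lambda>\<omega>. presample S (u \<omega>) (Suc n)) \<in> N \<rightarrow>\<^sub>M count_space UNIV"
  using measurable_compose_count[OF assms, of "insert (arrival S (Suc n))"]
  by (simp add: presample_def)

lemma measurable_sampling_time_Suc:
  assumes "(\<lambda>\<omega>. sample S (u \<omega>) n) \<in> N \<rightarrow>\<^sub>M count_space UNIV"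
  shows "Measurable.pred N (\<lambda>\<omega>. sampling_time S (u \<omega>) (Suc n))"
  using measurable_compose_count[OF assms, of "\<lambda>A. arrival S (Suc n) \<notin> A \<and>
    capacity S < card (insert (arrival S (Suc n)) A)"]
  by (simp add: presample_def sampling_time_def admitted_at_def)

lemma measurable_lookup:
  fixes f :: "nat \<Rightarrow> 'b \<Rightarrow> real"
  assumes "\<And>r. r < n \<Longrightarrow> (\<lambda>\<omega>. sample S (u \<omega>) r) \<in> N \<rightarrow>\<^sub>M count_space UNIV"
    and "\<And>k. k \<le> n \<Longrightarrow> f k \<in> borel_measurable N"
  shows "(\<lambda>\<omega>. f (adm_time S (u \<omega>) i n) \<omega>) \<in> borel_measurable N"
proof (rule measurable_compose_countable'[where I="{..n}"])
  show "(\<lambda>\<omega>. adm_time S (u \<omega>) i n) \<in> N \<rightarrow>\<^sub>M count_space {..n}"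
    using adm_time_le
    by (intro measurable_count_space_subset[OF measurable_adm_time[OF assms(1)]]) auto
qed (use assms(2) in auto)

context reservoir
begin

lemma measurable_sample_Suc:
  assumes n: "Suc n \<le> T"
    and s: "\<And>r. r \<le> n \<Longrightarrow> (\<lambda>\<omega>. sample S (u \<omega>) r) \<in> N \<rightarrow>\<^sub>M count_space UNIV"
    and v: "\<And>r. r \<in> {1..Suc n} \<Longrightarrow> (\<lambda>\<omega>. assigned S (u \<omega>) r) \<in> borel_measurable N"
  shows "(\<lambda>\<omega>. sample S (u \<omega>) (Suc n)) \<in> N \<rightarrow>\<^sub>M count_space UNIV"
proof -
  let ?P = "\<lambda>\<omega>. presample S (u \<omega>) (Suc n)"
  \<comment> \<open>Only \<open>assigned\<close> is assumed to be measurable, not the variables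
    themselves. Both have the same value at the admission times of presample members, the only ones
    that matter.\<close>
  define f where "f i \<omega> = weight S i (adm_time S (u \<omega>) i (Suc n)) (Suc n) /
    assigned S (u \<omega>) (adm_time S (u \<omega>) i (Suc n))" for i \<omega>
  have v': "(\<lambda>\<omega>. assigned S (u \<omega>) r) \<in> borel_measurable N" if "r \<le> Suc n" for r
    using v[of r] that by (cases "r = 0") (auto simp: assigned_def admitted_at_def)
  have f: "f i \<in> borel_measurable N" for i
    unfolding f_def using s v'
    by (intro measurable_lookup[where f="\<lambda>k \<omega>. weight S i k (Suc n) / assigned S (u \<omega>) k"]) auto
  have P: "?P \<in> N \<rightarrow>\<^sub>M count_space UNIV"
    by (rule measurable_presample_Suc) (rule s, simp)
  have "(\<lambda>\<omega>. arg_min_on (\<lambda>i. f i \<omega>) (?P \<omega>)) \<in> N \<rightarrow>\<^sub>M count_space UNIV"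
    using n by (intro measurable_arg_min_on[OF finite_E] P presample_E f) auto
  moreover have "arg_min_on (\<lambda>i. f i \<omega>) (?P \<omega>) =
    arg_min_on (\<lambda>i. priority S (u \<omega>) i (Suc n)) (?P \<omega>)" for \<omega>
  proof (rule arg_min_on_cong)
    fix i assume "i \<in> ?P \<omega>"
    from adm_time_presample[OF this] show "f i \<omega> = priority S (u \<omega>) i (Suc n)"
      by (simp add: f_def priority_def cur_weight_def assigned_def)
  qed
  ultimately have d: "(\<lambda>\<omega>. arg_min_on (\<lambda>i. priority S (u \<omega>) i (Suc n)) (?P \<omega>))
    \<in> N \<rightarrow>\<^sub>M count_space UNIV" (is "?d \<in> _") by simp
  have "(\<lambda>\<omega>. ?P \<omega> - {?d \<omega>}) \<in> N \<rightarrow>\<^sub>M count_space UNIV"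
  proof (rule measurable_compose_countable'[where I="Pow E" and g="?P" and f="\<lambda>B \<omega>. B - {?d \<omega>}"])
    show "?P \<in> N \<rightarrow>\<^sub>M count_space (Pow E)"
      using presample_E n by (intro measurable_count_space_subset[OF P]) auto
    show "(\<lambda>\<omega>. B - {?d \<omega>}) \<in> N \<rightarrow>\<^sub>M count_space UNIV" for B
      by (rule measurable_compose_count[OF d])
  qed (use finite_E in \<open>simp add: countable_finite\<close>)
  then show ?thesis
    unfolding sample_Suc_sampling
    by (rule measurable_if_pred[OF measurable_sampling_time_Suc[OF s[OF order_refl]] _ P])
qed

lemma measurable_sample_of_assigned:
  assumes "n \<le> T" and "\<And>r. r \<in> {1..n} \<Longrightarrow> (\<lambda>\<omega>. assigned S (u \<omega>) r) \<in> borel_measurable N"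
    and "r \<le> n"
  shows "(\<lambda>\<omega>. sample S (u \<omega>) r) \<in> N \<rightarrow>\<^sub>M count_space UNIV"
  using assms
proof (induction n arbitrary: r)
  case 0
  then show ?case by (simp add: sample_0)
next
  case (Suc n)
  have "(\<lambda>\<omega>. sample S (u \<omega>) k) \<in> N \<rightarrow>\<^sub>M count_space UNIV" if "k \<le> n" for k
    using Suc that by auto
  then have "(\<lambda>\<omega>. sample S (u \<omega>) (Suc n)) \<in> N \<rightarrow>\<^sub>M count_space UNIV"
    by (rule measurable_sample_Suc[OF Suc.prems(1) _ Suc.prems(2)])
  with Suc show ?case
    by (cases "r = Suc n") auto
qed

text \<open>Meant for the ambient measures, where the variables themselves are measurable. Whether a
  variable is assigned depends on the sample so far, and the next sample depends on the assigned
  variables, hence the joint induction.\<close>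

lemma measurable_sample_of_values:
  assumes "n \<le> T" and "\<And>r. r \<in> {1..n} \<Longrightarrow> (\<lambda>\<omega>. u \<omega> r) \<in> borel_measurable N"
  shows "(\<forall>r\<le>n. (\<lambda>\<omega>. sample S (u \<omega>) r) \<in> N \<rightarrow>\<^sub>M count_space UNIV) \<and>
    (\<forall>r\<in>{1..n}. (\<lambda>\<omega>. assigned S (u \<omega>) r) \<in> borel_measurable N)"
  using assms
proof (induction n)
  case 0
  then show ?case by (simp add: sample_0)
next
  case (Suc n)
  then have s: "(\<lambda>\<omega>. sample S (u \<omega>) k) \<in> N \<rightarrow>\<^sub>M count_space UNIV" if "k \<le> n" for k
    using that by auto
  have "Measurable.pred N (\<lambda>\<omega>. admitted_at S (u \<omega>) (Suc n))"
    using measurable_compose_count[OF s[of n], of "\<lambda>A. arrival S (Suc n) \<notin> A"]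
    by (simp add: admitted_at_def)
  then have "(\<lambda>\<omega>. assigned S (u \<omega>) (Suc n)) \<in> borel_measurable N"
    unfolding assigned_def using Suc.prems by (intro measurable_If) auto
  then have a: "(\<lambda>\<omega>. assigned S (u \<omega>) r) \<in> borel_measurable N" if "r \<in> {1..Suc n}" for r
    using Suc that by (cases "r = Suc n") auto
  then show ?case
    using measurable_sample_of_assigned[OF Suc.prems(1), of u N] by blast
qed

end

section \<open>The sigma-algebras \<open>info\<close> and \<open>info_except\<close>\<close>

lemma space_info [simp]: "space (info M S U s) = space M"
  and space_info_except [simp]: "space (info_except M S U e s) = space M"
  by (simp_all add: info_def info_except_def space_measure_of_conv)

lemma assigned_except_zero [simp]: "assigned_except S u e s 0 = 0"
  by (simp add: assigned_except_def assigned_def admitted_at_def)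

lemma measurable_assigned_info:
  assumes "r \<in> {1..s}"
  shows "(\<lambda>\<omega>. assigned S (\<lambda>k. U k \<omega>) r) \<in> borel_measurable (info M S U s)"
proof -
  have "(\<lambda>\<omega>. assigned S (\<lambda>k. U k \<omega>) r) -` B \<inter> space M \<in> sets (info M S U s)"
    if "B \<in> sets borel" for B
    unfolding info_def using assms that by (subst sets_measure_of) (auto intro!: sigma_sets.Basic)
  then show ?thesis by (auto intro!: measurableI)
qed

lemma measurable_assigned_except_info_except:
  assumes "r \<le> s"
  shows "(\<lambda>\<omega>. assigned_except S (\<lambda>k. U k \<omega>) e s r) \<in> borel_measurable (info_except M S U e s)"
proof (cases "r = 0")
  case False
  have "(\<lambda>\<omega>. assigned_except S (\<lambda>k. U k \<omega>) e s r) -` B \<inter> space M \<in> sets (info_except M S U e s)"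
    if "B \<in> sets borel" for B
    unfolding info_except_def using False assms that
    by (subst sets_measure_of) (auto intro!: sigma_sets.Basic)
  then show ?thesis by (auto intro!: measurableI)
qed simp

context reservoir
begin

lemma measurable_sample_info_except:
  assumes "r \<le> s" "s \<le> T"
  shows "(\<lambda>\<omega>. sample S (\<lambda>k. U k \<omega>) r) \<in> info_except M S U e s \<rightarrow>\<^sub>M count_space UNIV"
proof (rule measurable_count_space_UNIV_I)
  show "finite (Pow E)" using finite_E by simp
  show "sample S (\<lambda>k. U k \<omega>) r \<in> Pow E" for \<omega>
    using sample_E assms by auto
  show "{\<omega> \<in> space (info_except M S U e s). sample S (\<lambda>k. U k \<omega>) r = A}
    \<in> sets (info_except M S U e s)" for A
    unfolding space_info_except unfolding info_except_def using assms
    by (subst sets_measure_of) (auto intro!: sigma_sets.Basic)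
qed

lemma measurable_sample_info:
  assumes "r \<le> s" "s \<le> T"
  shows "(\<lambda>\<omega>. sample S (\<lambda>k. U k \<omega>) r) \<in> info M S U s \<rightarrow>\<^sub>M count_space UNIV"
  by (rule measurable_sample_of_assigned[where u="\<lambda>\<omega> k. U k \<omega>" and n=s])
    (use assms measurable_assigned_info in blast)+

text \<open>Which value is erased by \<open>assigned_except\<close> is decided by the samples and
  the admission time, and these can be computed from the assigned variables.\<close>

lemma sets_info_except_le_info:
  assumes "s \<le> T"
  shows "sets (info_except M S U e s) \<subseteq> sets (info M S U s)"
proof -
  let ?N = "info M S U s" and ?u = "\<lambda>\<omega> k. U k \<omega>"
  note sm = measurable_sample_info[OF _ assms, where M=M and U=U]
  have 1: "{\<omega> \<in> space M. sample S (?u \<omega>) r = A} \<in> sets ?N" if "r \<le> s" for r A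
    using measurable_sets[OF sm[OF that], of "{A}"] by (simp add: vimage_def Int_def conj_commute)
  have ad: "(\<lambda>\<omega>. adm_time S (?u \<omega>) e s) \<in> ?N \<rightarrow>\<^sub>M count_space UNIV"
    using sm by (intro measurable_adm_time) auto
  have pr: "Measurable.pred ?N (\<lambda>\<omega>. e \<in> sample S (?u \<omega>) s \<and> r = adm_time S (?u \<omega>) e s)" for r
    using measurable_compose_count[OF ad, of "\<lambda>k. r = k"]
      measurable_compose_count[OF sm[OF order_refl], of "\<lambda>A. e \<in> A"]
    by (intro pred_intros_logic) auto
  have 2: "(\<lambda>\<omega>. assigned_except S (?u \<omega>) e s r) \<in> borel_measurable ?N" if "r \<in> {1..s}" for r
    unfolding assigned_except_def
    by (rule measurable_if_pred[OF pr _ measurable_assigned_info[OF that]]) simp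
  show ?thesis
    unfolding info_except_def
  proof (subst sigma_le_sets, blast, intro conjI subsetI)
    show "space M \<in> sets ?N" using sets.top[of ?N] by simp
    fix A
    assume "A \<in> {{\<omega> \<in> space M. sample S (?u \<omega>) r = A} | r A. r \<le> s} \<union>
      {(\<lambda>\<omega>. assigned_except S (?u \<omega>) e s r) -` B \<inter> space M | r B. r \<in> {1..s} \<and> B \<in> sets borel}"
    then show "A \<in> sets ?N"
      using 1 measurable_sets[OF 2] by auto
  qed
qed

lemma sets_info_le:
  assumes "\<And>r. r \<in> {1..T} \<Longrightarrow> U r \<in> borel_measurable M" "s \<le> T"
  shows "sets (info M S U s) \<subseteq> sets M"
proof -
  have "(\<lambda>\<omega>. assigned S (\<lambda>k. U k \<omega>) r) \<in> borel_measurable M" if "r \<in> {1..s}" for r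
    using measurable_sample_of_values[of T "\<lambda>\<omega> k. U k \<omega>" M] assms that by auto
  then show ?thesis
    unfolding info_def by (subst sigma_le_sets) (auto intro: measurable_sets)
qed

lemma measurable_info_mono:
  assumes "X \<in> info_except M S U e s \<rightarrow>\<^sub>M L" "s \<le> T"
  shows "X \<in> info M S U s \<rightarrow>\<^sub>M L"
  using assms(1) sets_info_except_le_info[OF assms(2), of M U e] by (auto simp: measurable_def)

lemma measurable_info_except_mono:
  assumes "\<And>r. r \<in> {1..T} \<Longrightarrow> U r \<in> borel_measurable M" "X \<in> info_except M S U e s \<rightarrow>\<^sub>M L" "s \<le> T"
  shows "X \<in> M \<rightarrow>\<^sub>M L"
  using measurable_info_mono[OF assms(2,3)] sets_info_le[of U M s, OF assms(1,3)]
  by (auto simp: measurable_def)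

lemma assigned_except_Suc:
  assumes "e \<in> sample S u n" "e \<in> sample S u (Suc n)" "r \<le> n"
  shows "assigned_except S u e (Suc n) r = assigned_except S u e n r"
  using assms by (simp add: assigned_except_def adm_time_Suc_sample)

text \<open>As long as \<open>e\<close> stays in the sample, the same index is hidden at both times,
  so on this event the generators at time \<open>n\<close> coincide with generators at the next
  time. The sets whose trace on the event is measurable form a sigma-algebra, which extends this to
  all of \<open>info_except\<close> at time \<open>n\<close>. Cutting off to 0 elsewhere suffices
  for quantities that vanish when \<open>e\<close> is not sampled.\<close>

lemma measurable_info_except_Suc:
  fixes X :: "'a \<Rightarrow> real"
  assumes X: "X \<in> borel_measurable (info_except M S U e n)" and n: "Suc n \<le> T"
  shows "(\<lambda>\<omega>. if e \<in> sample S (\<lambda>k. U k \<omega>) n \<and> e \<in> sample S (\<lambda>k. U k \<omega>) (Suc n) then X \<omega> else 0)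
    \<in> borel_measurable (info_except M S U e (Suc n))"
proof -
  let ?N = "info_except M S U e (Suc n)" and ?u = "\<lambda>\<omega> k. U k \<omega>"
  define D where "D = {\<omega> \<in> space M. e \<in> sample S (?u \<omega>) n \<and> e \<in> sample S (?u \<omega>) (Suc n)}"
  note sm = measurable_sample_info_except[OF _ n, where M=M and U=U and e=e]
  have pD: "Measurable.pred ?N (\<lambda>\<omega>. e \<in> sample S (?u \<omega>) n \<and> e \<in> sample S (?u \<omega>) (Suc n))"
    using measurable_compose_count[OF sm, of _ "\<lambda>A. e \<in> A"] by (intro pred_intros_logic) auto
  then have D: "D \<in> sets ?N" by (simp add: D_def pred_def)
  have gen: "A \<inter> D \<in> sets ?N"
    if "A \<in> sigma_sets (space M) ({{\<omega> \<in> space M. sample S (?u \<omega>) r = A} | r A. r \<le> n} \<union>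
      {(\<lambda>\<omega>. assigned_except S (?u \<omega>) e n r) -` B \<inter> space M | r B. r \<in> {1..n} \<and> B \<in> sets borel})" for A
    using that
  proof induction
    case (Basic A)
    then consider r A' where "A = {\<omega> \<in> space M. sample S (?u \<omega>) r = A'}" "r \<le> n"
      | r B where "A = (\<lambda>\<omega>. assigned_except S (?u \<omega>) e n r) -` B \<inter> space M" "r \<le> n" "B \<in> sets borel"
      by auto
    then show ?case
    proof cases
      case 1
      have "A \<in> sets ?N"
        using measurable_sets[OF sm, of r "{A'}"] 1
        by (simp add: vimage_def Int_def conj_commute)
      then show ?thesis using D by blast
    next
      case 2
      have "A \<inter> D = ((\<lambda>\<omega>. assigned_except S (?u \<omega>) e (Suc n) r) -` B \<inter> space M) \<inter> D"
        using assigned_except_Suc[OF _ _ 2(2)] by (auto simp: D_def 2(1))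
      moreover have "(\<lambda>\<omega>. assigned_except S (?u \<omega>) e (Suc n) r) -` B \<inter> space M \<in> sets ?N"
        using measurable_sets[OF measurable_assigned_except_info_except 2(3), of r "Suc n" S U e M] 2
        by simp
      ultimately show ?thesis using D by auto
    qed
  next
    case (Compl A)
    have "(space M - A) \<inter> D = D - A \<inter> D" by (auto simp: D_def)
    then show ?case using D Compl by auto
  next
    case (Union A)
    have "\<Union> (range A) \<inter> D = (\<Union>i. A i \<inter> D)" by auto
    moreover have "(\<Union>i. A i \<inter> D) \<in> sets ?N"
      by (intro sets.countable_UN) (use Union.IH in blast)
    ultimately show ?case by (simp only:)
  qed simp
  show ?thesis
  proof (rule measurableI)
    fix B :: "real set" assume B: "B \<in> sets borel"
    have "X -` B \<inter> space M \<in> sets (info_except M S U e n)"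
      using measurable_sets[OF X B] by simp
    then have 1: "X -` B \<inter> space M \<inter> D \<in> sets ?N"
      unfolding info_except_def[of M S U e n] by (subst (asm) sets_measure_of) (auto intro: gen)
    \<comment> \<open>Off \<open>D\<close> the function is 0, so the complement of \<open>D\<close>
      belongs to the preimage iff \<open>0 \<in> B\<close>.\<close>
    have "(\<lambda>\<omega>. if e \<in> sample S (?u \<omega>) n \<and> e \<in> sample S (?u \<omega>) (Suc n) then X \<omega> else 0) -` B \<inter> space ?N
      = (X -` B \<inter> space M \<inter> D) \<union> (if 0 \<in> B then space ?N - D else {})"
      by (auto simp: D_def split: if_splits)
    also have "\<dots> \<in> sets ?N"
    proof (cases "0 \<in> B")
      case True
      then show ?thesis using sets.Un[OF 1 sets.compl_sets[OF D]] by (simp only: if_True)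
    qed (use 1 in simp)
    finally show "(\<lambda>\<omega>. if e \<in> sample S (?u \<omega>) n \<and> e \<in> sample S (?u \<omega>) (Suc n) then X \<omega> else 0) -` B \<inter>
      space ?N \<in> sets ?N" .
  qed simp
qed

text \<open>While \<open>e\<close> is retained, its admission time is the only hidden index, and the
  other edges hold variables at different indices; their priorities are therefore visible.\<close>

lemma measurable_other_threshold_info_except:
  assumes n: "Suc n \<le> T"
  shows "(\<lambda>\<omega>. if e \<in> sample S (\<lambda>k. U k \<omega>) (Suc n) then other_threshold S (\<lambda>k. U k \<omega>) e (Suc n) else 1)
    \<in> borel_measurable (info_except M S U e (Suc n))"
proof -
  let ?N = "info_except M S U e (Suc n)" and ?u = "\<lambda>\<omega> k. U k \<omega>"
  note sm = measurable_sample_info_except[OF _ n, where M=M and U=U and e=e]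
  define f where "f i \<omega> = weight S i (adm_time S (?u \<omega>) i (Suc n)) (Suc n) /
    assigned_except S (?u \<omega>) e (Suc n) (adm_time S (?u \<omega>) i (Suc n))" for i \<omega>
  define z where "z \<omega> = Min ((\<lambda>i. f i \<omega>) ` (presample S (?u \<omega>) (Suc n) - {e}))" for \<omega>
  have "f i \<in> borel_measurable ?N" for i
    unfolding f_def using sm
    by (intro measurable_lookup[where
        f="\<lambda>k \<omega>. weight S i k (Suc n) / assigned_except S (?u \<omega>) e (Suc n) k"]
        borel_measurable_divide measurable_assigned_except_info_except) auto
  moreover have "(\<lambda>\<omega>. presample S (?u \<omega>) (Suc n) - {e}) \<in> ?N \<rightarrow>\<^sub>M count_space UNIV"
    using measurable_compose_count[OF measurable_presample_Suc[OF sm], of n "\<lambda>A. A - {e}"] by simp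
  ultimately have z: "z \<in> borel_measurable ?N"
    unfolding z_def using presample_E[of "Suc n"] n
    by (intro borel_measurable_Min_set[OF finite_E]) auto
  have eq: "other_threshold S (?u \<omega>) e (Suc n) = z \<omega>" if e: "e \<in> sample S (?u \<omega>) (Suc n)" for \<omega>
  proof -
    have "priority S (?u \<omega>) i (Suc n) = f i \<omega>" if i: "i \<in> presample S (?u \<omega>) (Suc n) - {e}" for i
    proof -
      have "adm_time S (?u \<omega>) i (Suc n) \<noteq> adm_time S (?u \<omega>) e (Suc n)"
        using adm_time_presample[of i S "?u \<omega>" "Suc n"] adm_time_sample[OF e] i by auto
      then show ?thesis
        using adm_time_presample[of i S "?u \<omega>" "Suc n"] i
        by (simp add: f_def priority_def cur_weight_def assigned_except_def assigned_def)
    qed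
    then show ?thesis
      unfolding z_def other_threshold_def by (intro arg_cong[where f=Min] image_cong) auto
  qed
  have "Measurable.pred ?N (\<lambda>\<omega>. e \<in> sample S (?u \<omega>) (Suc n))"
    using measurable_compose_count[OF sm[OF order_refl], of "\<lambda>A. e \<in> A"] by simp
  then have "(\<lambda>\<omega>. if e \<in> sample S (?u \<omega>) (Suc n) then z \<omega> else 1) \<in> borel_measurable ?N"
    using z by (intro measurable_if_pred) auto
  then show ?thesis using eq by (simp cong: if_cong)
qed

text \<open>The induction carries \<open>prior_prob\<close> one time ahead: its value for the next
  time is settled as soon as the outcome of the present time is known. At a sampling time the new
  minimum is the next \<open>prior_prob\<close>, and its ratio to the old one is
  \<open>cond_prob_ret\<close>.\<close>

lemma measurable_cond_prob_ret_Suc: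
  assumes n: "Suc n \<le> T"
    and p: "(\<lambda>\<omega>. if e \<in> sample S (\<lambda>k. U k \<omega>) n then prior_prob S (\<lambda>k. U k \<omega>) e (Suc n) else 1)
      \<in> borel_measurable (info_except M S U e n)"
  shows "(\<lambda>\<omega>. if e \<in> sample S (\<lambda>k. U k \<omega>) (Suc n) then cond_prob_ret S (\<lambda>k. U k \<omega>) e (Suc n) else 1)
      \<in> borel_measurable (info_except M S U e (Suc n))" (is ?q)
    and "(\<lambda>\<omega>. if e \<in> sample S (\<lambda>k. U k \<omega>) (Suc n)
        then prior_prob S (\<lambda>k. U k \<omega>) e (Suc (Suc n)) else 1)
      \<in> borel_measurable (info_except M S U e (Suc n))" (is ?p)
proof -
  let ?N = "info_except M S U e (Suc n)" and ?u = "\<lambda>\<omega> k. U k \<omega>"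
  let ?D = "\<lambda>\<omega>. e \<in> sample S (?u \<omega>) n \<and> e \<in> sample S (?u \<omega>) (Suc n)"
  let ?F = "\<lambda>\<omega>. e \<in> sample S (?u \<omega>) (Suc n)"
  note sm = measurable_sample_info_except[OF _ n, where M=M and U=U and e=e]
  have pe: "Measurable.pred ?N (\<lambda>\<omega>. e \<in> sample S (?u \<omega>) r)" if "r \<le> Suc n" for r
    using measurable_compose_count[OF sm[OF that], of "\<lambda>A. e \<in> A"] by simp
  have pD: "Measurable.pred ?N ?D" and pF: "Measurable.pred ?N ?F"
    by (intro pred_intros_logic pe; simp)+
  define z where "z \<omega> = (if ?F \<omega> then other_threshold S (?u \<omega>) e (Suc n) else 1)" for \<omega>
  define w where "w \<omega> = cur_weight S (?u \<omega>) e (Suc n)" for \<omega>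
  define \<pi> where "\<pi> \<omega> = (if ?D \<omega> then prior_prob S (?u \<omega>) e (Suc n) else 1)" for \<omega>
  have z: "z \<in> borel_measurable ?N"
    unfolding z_def by (rule measurable_other_threshold_info_except[OF n])
  have w: "w \<in> borel_measurable ?N"
    unfolding w_def cur_weight_def using sm
    by (intro measurable_lookup[where f="\<lambda>k \<omega>. weight S e k (Suc n)"]) auto
  \<comment> \<open>\<open>measurable_info_except_Suc\<close> gives the value 0 off
    \<open>?D\<close>; the outer conditional replaces it by 1.\<close>
  have "(\<lambda>\<omega>. if ?D \<omega> then (if ?D \<omega> then (if e \<in> sample S (?u \<omega>) n then
      prior_prob S (?u \<omega>) e (Suc n) else 1) else 0) else 1) \<in> borel_measurable ?N"
    by (rule measurable_if_pred[OF pD measurable_info_except_Suc[OF p n]]) simp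
  moreover have "(\<lambda>\<omega>. if ?D \<omega> then (if ?D \<omega> then (if e \<in> sample S (?u \<omega>) n then
      prior_prob S (?u \<omega>) e (Suc n) else 1) else 0) else 1) = \<pi>"
    by (auto simp: \<pi>_def)
  ultimately have \<pi>: "\<pi> \<in> borel_measurable ?N" by simp
  have pr: "prior_prob S (?u \<omega>) e (Suc n) = \<pi> \<omega>" if "?F \<omega>" for \<omega>
  proof (cases "e \<in> sample S (?u \<omega>) n")
    case False
    then have "adm_time S (?u \<omega>) e (Suc n) = Suc n"
      using that sample_Suc_subset[of S "?u \<omega>" n]
      by (auto simp: adm_time_Suc presample_def admitted_at_def)
    then show ?thesis using False by (simp add: prior_prob_new \<pi>_def)
  qed (use that in \<open>simp add: \<pi>_def\<close>)
  have pS: "Measurable.pred ?N (\<lambda>\<omega>. sampling_time S (?u \<omega>) (Suc n))"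
    using sm by (intro measurable_sampling_time_Suc) auto
  have "(\<lambda>\<omega>. if ?F \<omega> then (if sampling_time S (?u \<omega>) (Suc n) then min (\<pi> \<omega>) (w \<omega> / z \<omega>) / \<pi> \<omega>
    else 1) else 1) \<in> borel_measurable ?N"
    using \<pi> w z by (intro measurable_if_pred pF pS borel_measurable_min borel_measurable_divide) auto
  moreover have "(\<lambda>\<omega>. if ?F \<omega> then (if sampling_time S (?u \<omega>) (Suc n) then
    min (\<pi> \<omega>) (w \<omega> / z \<omega>) / \<pi> \<omega> else 1) else 1) =
    (\<lambda>\<omega>. if ?F \<omega> then cond_prob_ret S (?u \<omega>) e (Suc n) else 1)"
    by (auto simp: cond_prob_ret_def ret_prob_retained pr z_def w_def)
  ultimately show ?q by simp
  have "(\<lambda>\<omega>. if ?F \<omega> then (if sampling_time S (?u \<omega>) (Suc n) then min (\<pi> \<omega>) (w \<omega> / z \<omega>)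
    else \<pi> \<omega>) else 1) \<in> borel_measurable ?N"
    using \<pi> w z by (intro measurable_if_pred pF pS borel_measurable_min borel_measurable_divide) auto
  moreover have "(\<lambda>\<omega>. if ?F \<omega> then (if sampling_time S (?u \<omega>) (Suc n) then
    min (\<pi> \<omega>) (w \<omega> / z \<omega>) else \<pi> \<omega>) else 1) =
    (\<lambda>\<omega>. if ?F \<omega> then prior_prob S (?u \<omega>) e (Suc (Suc n)) else 1)"
    by (auto simp: prior_prob_Suc ret_prob_retained pr z_def w_def)
  ultimately show ?p by simp
qed

lemma measurable_prior_prob_info_except:
  assumes "n \<le> T"
  shows "(\<lambda>\<omega>. if e \<in> sample S (\<lambda>k. U k \<omega>) n then prior_prob S (\<lambda>k. U k \<omega>) e (Suc n) else 1)
    \<in> borel_measurable (info_except M S U e n)"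
  using assms
proof (induction n)
  case 0
  then show ?case by (simp add: sample_0)
next
  case (Suc n)
  then show ?case by (intro measurable_cond_prob_ret_Suc(2)) auto
qed

lemma measurable_cond_prob_ret_info_except:
  assumes "Suc n \<le> T"
  shows "(\<lambda>\<omega>. if e \<in> sample S (\<lambda>k. U k \<omega>) (Suc n) then cond_prob_ret S (\<lambda>k. U k \<omega>) e (Suc n) else 1)
    \<in> borel_measurable (info_except M S U e (Suc n))"
  using assms by (intro measurable_cond_prob_ret_Suc(1) measurable_prior_prob_info_except) auto

lemma pred_sample_info_except:
  assumes "r \<le> s" "s \<le> T"
  shows "Measurable.pred (info_except M S U e s) (\<lambda>\<omega>. i \<in> sample S (\<lambda>k. U k \<omega>) r)"
  by (rule measurable_compose_count[OF measurable_sample_info_except[OF assms], of "\<lambda>A. i \<in> A"])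

lemma measurable_count_est_info_except:
  assumes "n \<le> T"
  shows "(\<lambda>\<omega>. count_est S (\<lambda>k. U k \<omega>) e n) \<in> borel_measurable (info_except M S U e n)"
  using assms
proof (induction n)
  case 0
  then show ?case by simp
next
  case (Suc n)
  let ?u = "\<lambda>\<omega> k. U k \<omega>"
  let ?D = "\<lambda>\<omega>. e \<in> sample S (?u \<omega>) n \<and> e \<in> sample S (?u \<omega>) (Suc n)"
  let ?F = "\<lambda>\<omega>. e \<in> sample S (?u \<omega>) (Suc n)"
  have "(\<lambda>\<omega>. if ?F \<omega> then ((if ?D \<omega> then count_est S (?u \<omega>) e n else 0) +
      of_bool (arrival S (Suc n) = e)) / (if ?F \<omega> then cond_prob_ret S (?u \<omega>) e (Suc n) else 1) else 0)
    \<in> borel_measurable (info_except M S U e (Suc n))"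
    by (rule measurable_if_pred[OF pred_sample_info_except[OF order_refl Suc.prems]
          borel_measurable_divide[OF borel_measurable_add[OF
            measurable_info_except_Suc[OF Suc.IH Suc.prems] borel_measurable_const]
            measurable_cond_prob_ret_info_except[OF Suc.prems]] borel_measurable_const])
      (use Suc.prems in simp)
  \<comment> \<open>Under \<open>?F\<close> the guard \<open>?D\<close> fails only if
    \<open>e\<close> was absent before, and then the earlier estimate is 0 anyway.\<close>
  moreover have "(\<lambda>\<omega>. if ?F \<omega> then ((if ?D \<omega> then count_est S (?u \<omega>) e n else 0) +
      of_bool (arrival S (Suc n) = e)) / (if ?F \<omega> then cond_prob_ret S (?u \<omega>) e (Suc n) else 1) else 0) =
    (\<lambda>\<omega>. count_est S (?u \<omega>) e (Suc n))"
    by (auto simp: count_est_eq_0)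
  ultimately show ?case by (simp del: count_est.simps)
qed

lemma var_step_eq_0:
  "e \<notin> sample S u t \<Longrightarrow> var_step S u e t v = 0"
  by (simp add: var_step_def count_est_eq_0)

lemma measurable_var_step_info_except:
  assumes V: "stored_with M S U e n V" and n: "Suc n \<le> T"
  shows "(\<lambda>\<omega>. var_step S (\<lambda>k. U k \<omega>) e (Suc n) (V \<omega>)) \<in> borel_measurable (info_except M S U e (Suc n))"
proof -
  let ?u = "\<lambda>\<omega> k. U k \<omega>" and ?N = "info_except M S U e (Suc n)"
  let ?D = "\<lambda>\<omega>. e \<in> sample S (?u \<omega>) n \<and> e \<in> sample S (?u \<omega>) (Suc n)"
  let ?F = "\<lambda>\<omega>. e \<in> sample S (?u \<omega>) (Suc n)"
  let ?q = "\<lambda>\<omega>. if ?F \<omega> then cond_prob_ret S (?u \<omega>) e (Suc n) else 1"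
  have 1: "(\<lambda>\<omega>. if ?D \<omega> then V \<omega> else 0) \<in> borel_measurable ?N"
    using V by (intro measurable_info_except_Suc n) (simp add: stored_with_def)
  have 2: "?q \<in> borel_measurable ?N" by (rule measurable_cond_prob_ret_info_except[OF n])
  have 3: "(\<lambda>\<omega>. count_est S (?u \<omega>) e (Suc n)) \<in> borel_measurable ?N"
    by (rule measurable_count_est_info_except[OF n])
  have 4: "Measurable.pred ?N ?F" by (rule pred_sample_info_except[OF order_refl n])
  have "(\<lambda>\<omega>. (count_est S (?u \<omega>) e (Suc n))\<^sup>2 * (1 - ?q \<omega>) +
      (if ?F \<omega> then (if ?D \<omega> then V \<omega> else 0) / ?q \<omega> else 0)) \<in> borel_measurable ?N"
    using 1 2 3 4 by measurable
  then show ?thesis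
  \<comment> \<open>Guarding \<open>V\<close> by \<open>?D\<close> loses nothing, since
    \<open>stored_with\<close> makes \<open>V\<close> vanish off the earlier sample. Off the present
    sample the factor with the probability is multiplied by a count estimate of 0.\<close>
  proof (rule measurable_cong[THEN iffD1, rotated])
    fix \<omega> assume "\<omega> \<in> space ?N"
    then have "e \<notin> sample S (?u \<omega>) n \<Longrightarrow> V \<omega> = 0" using V by (simp add: stored_with_def)
    then show "(count_est S (?u \<omega>) e (Suc n))\<^sup>2 * (1 - ?q \<omega>) +
      (if ?F \<omega> then (if ?D \<omega> then V \<omega> else 0) / ?q \<omega> else 0) =
      var_step S (?u \<omega>) e (Suc n) (V \<omega>)"
      by (auto simp: var_step_def count_est_eq_0 simp del: count_est.simps)
  qed
qed

end

section \<open>Probabilities as functions of the variables up to the present\<close>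

lemma ret_prob_cong:
  assumes "1 \<le> t" "\<And>k. k \<in> {1..t} \<Longrightarrow> u k = v k"
  shows "prior_prob S u e t = prior_prob S v e t" "sampling_time S u t = sampling_time S v t"
    "e \<in> presample S u t \<Longrightarrow> ret_prob S u e t = ret_prob S v e t"
proof -
  have st: "state S u n = state S v n" if "n \<le> t" for n
    using that assms by (intro state_cong) auto
  have ad: "adm_time S u i s = adm_time S v i s" if "s \<le> t" for i s
    using st[OF that] by (simp add: adm_time_def)
  have sa: "sample S u s = sample S v s" if "s \<le> t" for s
    using st[OF that] by (simp add: sample_def)
  have pre: "presample S u s = presample S v s" if "s \<le> t" for s
    using sa[of "s - 1"] that by (simp add: presample_def)
  have samp: "sampling_time S u s = sampling_time S v s" if "s \<le> t" for s
    using sa[of "s - 1"] pre[OF that] that by (simp add: sampling_time_def admitted_at_def)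
  show "sampling_time S u t = sampling_time S v t" by (rule samp) simp
  have thr: "threshold S u s = threshold S v s" if "1 \<le> s" "s \<le> t" for s
  proof -
    have "priority S u i s = priority S v i s" if "i \<in> presample S u s" for i
      using adm_time_presample[OF that \<open>1 \<le> s\<close>] ad[OF \<open>s \<le> t\<close>] assms(2) \<open>s \<le> t\<close>
      by (simp add: priority_def cur_weight_def)
    then show ?thesis
      unfolding threshold_def pre[OF \<open>s \<le> t\<close>, symmetric]
      by (intro arg_cong[where f=Min] image_cong) auto
  qed
  have prior: "prior_sampling_times S u e s = prior_sampling_times S v e s" if "s \<le> t" for s
    using that samp by (auto simp: prior_sampling_times_def ad)
  have ret: "ret_prob S u e s = ret_prob S v e s" if "1 \<le> s" "s \<le> t" for s
    using that
  proof (induction s rule: less_induct)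
    case (less s)
    have "ret_prob S u e (Max (prior_sampling_times S v e s)) =
      ret_prob S v e (Max (prior_sampling_times S v e s))" if ne: "prior_sampling_times S v e s \<noteq> {}"
    proof -
      have "Max (prior_sampling_times S v e s) \<in> prior_sampling_times S v e s"
        using ne by (intro Max_in) (simp_all add: prior_sampling_times_def)
      then have "1 \<le> Max (prior_sampling_times S v e s)" "Max (prior_sampling_times S v e s) < s"
        using sampling_timeD by (auto simp: prior_sampling_times_def)
      with less show ?thesis by auto
    qed
    then show ?case
      using less.prems prior[of s] thr[of s] ad[of s]
      by (simp add: ret_prob_eq[of S _ e s] prior_prob_def cur_weight_def)
  qed
  show "e \<in> presample S u t \<Longrightarrow> ret_prob S u e t = ret_prob S v e t"
    using ret assms by simp
  show "prior_prob S u e t = prior_prob S v e t"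
  proof (cases "prior_sampling_times S v e t = {}")
    case False
    have "Max (prior_sampling_times S v e t) \<in> prior_sampling_times S v e t"
      using False by (intro Max_in) (simp_all add: prior_sampling_times_def)
    then have "1 \<le> Max (prior_sampling_times S v e t)" "Max (prior_sampling_times S v e t) \<le> t"
      using sampling_timeD by (auto simp: prior_sampling_times_def)
    with False prior[of t] ret show ?thesis by (simp add: prior_prob_def)
  qed (use prior[of t] in \<open>simp add: prior_prob_def\<close>)
qed

text \<open>Lets the full sequence of variables be replaced by its restriction to
  \<open>{1..T}\<close>.\<close>

lemma cond_prob_ret_cong:
  assumes "1 \<le> t" "\<And>k. k \<in> {1..t} \<Longrightarrow> u k = v k" "e \<in> presample S u t"
  shows "cond_prob_ret S u e t = cond_prob_ret S v e t"
  using ret_prob_cong(1)[where S=S and e=e, OF assms(1,2)] ret_prob_cong(2)[where S=S, OF assms(1,2)]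
    ret_prob_cong(3)[OF assms]
  by (simp add: cond_prob_ret_def)

section \<open>Resampling one variable\<close>

definition unif :: "real measure" where
  "unif = uniform_measure lborel {0<..1}"

lemma sets_unif [simp, measurable_cong]: "sets unif = sets borel"
  and space_unif [simp]: "space unif = UNIV"
  by (simp_all add: unif_def)

lemma prob_space_unif: "prob_space unif"
  unfolding unif_def by (rule prob_space_uniform_measure) simp_all

interpretation unif: prob_space unif by (rule prob_space_unif)

lemma emeasure_unif_Ioo:
  assumes "0 \<le> p" "p \<le> 1"
  shows "emeasure unif {0<..<p} = ennreal p"
proof -
  have "{0<..1} \<inter> {0<..<p} = {0<..<p}" using assms by auto
  then show ?thesis using assms by (simp add: unif_def divide_ennreal_def)
qed

lemma AE_unif_neq: "AE x in unif. x \<noteq> c"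
proof (rule AE_I)
  have "emeasure lborel ({0<..1} \<inter> {c}) \<le> emeasure lborel {c}"
    by (intro emeasure_mono) auto
  then show "emeasure unif {c} = 0" by (simp add: unif_def)
qed auto

lemma AE_unif_Ioo: "AE x in unif. 0 < x \<and> x < 1"
proof -
  have "AE x in unif. x \<in> {0<..<1}"
    using emeasure_unif_Ioo[of 1] by (intro unif.AE_prob_1) (simp add: unif.emeasure_eq_measure)
  then show ?thesis by simp
qed

interpretation unif_product: product_sigma_finite "\<lambda>_. unif"
  by standard

text \<open>Tonelli's theorem with coordinate \<open>a\<close> integrated innermost.\<close>

lemma nn_integral_PiM_unif_coord:
  fixes T :: nat
  assumes "a \<in> {1..T}" "F \<in> borel_measurable (PiM {1..T} (\<lambda>_. unif))"
  shows "(\<integral>\<^sup>+u. F u \<partial>PiM {1..T} (\<lambda>_. unif)) =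
    (\<integral>\<^sup>+u. (\<integral>\<^sup>+x. F (u(a := x)) \<partial>unif) \<partial>PiM ({1..T} - {a}) (\<lambda>_. unif))"
proof -
  have "insert a ({1..T} - {a}) = {1..T}" using assms(1) by auto
  then show ?thesis
    using unif_product.product_nn_integral_insert[of "{1..T} - {a}" a F] assms(2) by simp
qed

lemma fun_upd_space_PiM_unif:
  fixes T :: nat
  assumes "a \<in> {1..T}" "u \<in> space (PiM ({1..T} - {a}) (\<lambda>_. unif))"
  shows "u(a := x) \<in> space (PiM {1..T} (\<lambda>_. unif))"
  using assms by (auto simp: space_PiM PiE_def extensional_def)

text \<open>With all other coordinates fixed, the forbidden equation determines coordinate
  \<open>b\<close>, and a single point is null for \<open>unif\<close>.\<close>

lemma AE_PiM_unif_neq: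
  fixes T :: nat
  assumes "b \<in> {1..T}" "c \<in> {1..T}" "b \<noteq> c"
  shows "AE u in PiM {1..T} (\<lambda>_. unif). u b \<noteq> \<kappa> * u c"
proof -
  let ?P = "PiM {1..T} (\<lambda>_. unif)"
  define N where "N = {u \<in> space ?P. u b = \<kappa> * u c}"
  have [measurable]: "(\<lambda>u. u b) \<in> borel_measurable ?P" "(\<lambda>u. u c) \<in> borel_measurable ?P"
    using assms measurable_component_singleton[of _ "{1..T}" "\<lambda>_. unif"] by simp_all
  have N [measurable]: "N \<in> sets ?P" unfolding N_def by measurable
  have "emeasure ?P N = (\<integral>\<^sup>+u. indicator N u \<partial>?P)"
    by (rule nn_integral_indicator[OF N, symmetric])
  also have "\<dots> = (\<integral>\<^sup>+u. (\<integral>\<^sup>+x. indicator N (u(b := x)) \<partial>unif) \<partial>PiM ({1..T} - {b}) (\<lambda>_. unif))"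
    by (rule nn_integral_PiM_unif_coord[OF assms(1) borel_measurable_indicator[OF N]])
  also have "\<dots> = (\<integral>\<^sup>+u. 0 \<partial>PiM ({1..T} - {b}) (\<lambda>_. unif))"
  proof (rule nn_integral_cong)
    fix u assume "u \<in> space (PiM ({1..T} - {b}) (\<lambda>_. unif))"
    have "(\<integral>\<^sup>+x. indicator N (u(b := x)) \<partial>unif) = (\<integral>\<^sup>+x. 0 \<partial>unif)"
      using AE_unif_neq[of "\<kappa> * u c"] assms(3)
      by (intro nn_integral_cong_AE) (auto simp: N_def)
    then show "(\<integral>\<^sup>+x. indicator N (u(b := x)) \<partial>unif) = 0" by simp
  qed
  finally have "N \<in> null_sets ?P" using N by (simp add: null_sets_def)
  from AE_not_in[OF this] show ?thesis
    by (rule AE_mp) (auto simp: N_def)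
qed

context reservoir
begin

abbreviation P :: "(nat \<Rightarrow> real) measure" where
  "P \<equiv> PiM {1..T} (\<lambda>_. unif)"

lemma component_P: "k \<in> {1..T} \<Longrightarrow> (\<lambda>u. u k) \<in> borel_measurable P"
  using measurable_component_singleton[of k "{1..T}" "\<lambda>_. unif"] by simp

text \<open>The absence of ties in the form to which \<open>AE_PiM_unif_neq\<close> applies.
  Clearing the denominators uses the positivity in the first conjunct.\<close>

lemma generic_iff:
  "generic u \<longleftrightarrow> (\<forall>k\<in>{1..T}. 0 < u k \<and> u k < 1) \<and>
    (\<forall>i\<in>E. \<forall>j\<in>E. \<forall>b\<in>{1..T}. \<forall>c\<in>{1..T}. \<forall>s\<in>{1..T}. b \<noteq> c \<longrightarrow> b \<le> s \<longrightarrow> c \<le> s \<longrightarrow>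
      u b \<noteq> weight S i b s / weight S j c s * u c)"
proof -
  have "weight S i b s / u b \<noteq> weight S j c s / u c \<longleftrightarrow>
      u b \<noteq> weight S i b s / weight S j c s * u c"
    if "\<forall>k\<in>{1..T}. 0 < u k \<and> u k < 1" "i \<in> E" "j \<in> E" "b \<in> {1..T}" "c \<in> {1..T}" "s \<in> {1..T}"
      "b \<le> s" "c \<le> s" for i j b c s
  proof -
    have "0 < weight S i b s" "0 < weight S j c s" "0 < u b" "0 < u c"
      using that by (auto intro!: weight_pos)
    then show ?thesis by (auto simp: field_simps)
  qed
  then show ?thesis unfolding generic_def by (intro conj_cong refl ball_cong imp_cong) auto
qed

lemma AE_generic: "AE u in P. generic u"
  unfolding generic_iff
proof (intro AE_conjI AE_finite_allI AE_impI finite_E)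
  show "AE u in P. 0 < u k" "AE u in P. u k < 1" if "k \<in> {1..T}" for k
    using AE_PiM_component[of "{1..T}" "\<lambda>_. unif" k "\<lambda>x. 0 < x \<and> x < 1"] that AE_unif_Ioo
      prob_space_unif by auto
qed ((rule AE_PiM_unif_neq; assumption) | rule finite_atLeastAtMost)+

text \<open>Holds for each fixed \<open>u\<close>, not just for almost every one: a single generic
  value \<open>y\<close> guarantees the conditions that do not involve coordinate \<open>a\<close>,
  and the others fail only for a null set of \<open>x\<close>.\<close>

lemma AE_generic_upd:
  assumes "generic (u(a := y))" "a \<in> {1..T}"
  shows "AE x in unif. generic (u(a := x))"
proof -
  have "AE x in unif. (0 < x \<and> x < 1) \<and> (\<forall>i\<in>E. \<forall>j\<in>E. \<forall>c\<in>{1..T}. \<forall>s\<in>{1..T}.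
      x \<noteq> weight S i a s / weight S j c s * u c)"
    by (intro AE_conjI AE_unif_Ioo AE_finite_allI finite_E finite_atLeastAtMost AE_unif_neq)
  then show ?thesis
  proof (rule AE_mp, intro AE_I2 impI)
    fix x assume x: "(0 < x \<and> x < 1) \<and> (\<forall>i\<in>E. \<forall>j\<in>E. \<forall>c\<in>{1..T}. \<forall>s\<in>{1..T}.
      x \<noteq> weight S i a s / weight S j c s * u c)"
    have neq: "weight S i a s / x \<noteq> weight S j c s / u c"
      if "i \<in> E" "j \<in> E" "c \<in> {1..T}" "s \<in> {1..T}" "c \<noteq> a" "a \<le> s" "c \<le> s" for i j c s
    proof -
      have "0 < weight S i a s" "0 < weight S j c s" "0 < u c"
        using that assms generic_pos[OF assms(1), of c] by (auto intro!: weight_pos)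
      moreover have "x \<noteq> weight S i a s / weight S j c s * u c" using x that by blast
      ultimately show ?thesis using x by (auto simp: field_simps)
    qed
    show "generic (u(a := x))"
      unfolding generic_def
    proof (intro conjI ballI impI)
      fix k assume "k \<in> {1..T}"
      then show "0 < (u(a := x)) k" "(u(a := x)) k < 1"
        using x assms(1) by (auto simp: generic_def dest!: bspec[of _ _ k] split: if_splits)
    next
      fix i j b c s
      assume *: "i \<in> E" "j \<in> E" "b \<in> {1..T}" "c \<in> {1..T}" "s \<in> {1..T}" "b \<noteq> c" "b \<le> s" "c \<le> s"
      consider "b = a" | "c = a" | "b \<noteq> a" "c \<noteq> a" by blast
      then show "weight S i b s / (u(a := x)) b \<noteq> weight S j c s / (u(a := x)) c"
      proof cases
        case 1 then show ?thesis using neq[of i j c s] * by auto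
      next
        case 2 then show ?thesis using neq[of j i b s] * by (metis fun_upd_apply)
      next
        case 3
        have "weight S i b s / (u(a := y)) b \<noteq> weight S j c s / (u(a := y)) c"
          using assms(1) * unfolding generic_def by blast
        with 3 show ?thesis by simp
      qed
    qed
  qed
qed

lemma measurable_generic: "{u \<in> space P. generic u} \<in> sets P"
proof -
  have 1: "Measurable.pred P (\<lambda>u. 0 < u k \<and> u k < 1)" if "k \<in> {1..T}" for k
    using component_P[OF that] by measurable
  have 2: "Measurable.pred P (\<lambda>u. weight S i b s / u b \<noteq> weight S j c s / u c)"
    if "b \<in> {1..T}" "c \<in> {1..T}" for i j b c s
  proof -
    have "(\<lambda>u. weight S i b s / u b) \<in> borel_measurable P"
      "(\<lambda>u. weight S j c s / u c) \<in> borel_measurable P"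
      by (rule borel_measurable_divide[OF borel_measurable_const component_P[OF that(1)]]
          borel_measurable_divide[OF borel_measurable_const component_P[OF that(2)]])+
    then show ?thesis unfolding pred_def by (rule borel_measurable_neq)
  qed
  have "Measurable.pred P generic"
    unfolding generic_def
    by (rule pred_intros_logic(3);
        intro pred_intros_finite(3) pred_intros_imp' finite_E finite_atLeastAtMost 1 2)
  then show ?thesis by (simp add: pred_def)
qed

section \<open>The identity for inverse probabilities on the product space\<close>

abbreviation infoP :: "'v uprod \<Rightarrow> nat \<Rightarrow> (nat \<Rightarrow> real) measure" where
  "infoP e s \<equiv> info_except P S (\<lambda>k u. u k) e s"

text \<open>The sets that contain both or neither of two given points are closed under complements
  and countable unions. As they include the generators, they include the level set of
  \<open>g\<close> through \<open>u\<close>.\<close>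

lemma infoP_separate:
  fixes g :: "(nat \<Rightarrow> real) \<Rightarrow> ennreal"
  assumes g: "g \<in> borel_measurable (infoP e s)"
    and uv: "u \<in> space P" "v \<in> space P"
    and sm: "\<And>r. r \<le> s \<Longrightarrow> sample S u r = sample S v r"
    and as: "\<And>r. r \<in> {1..s} \<Longrightarrow> assigned_except S u e s r = assigned_except S v e s r"
  shows "g u = g v"
proof -
  let ?G = "{{u \<in> space P. sample S u r = A} | r A. r \<le> s} \<union>
    {(\<lambda>u. assigned_except S u e s r) -` B \<inter> space P | r B. r \<in> {1..s} \<and> B \<in> sets borel}"
  have "g -` {g u} \<inter> space P \<in> sets (infoP e s)"
    using measurable_sets[OF g, of "{g u}"] by simp
  then have "g -` {g u} \<inter> space P \<in> sigma_sets (space P) ?G"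
    unfolding info_except_def by (subst (asm) sets_measure_of) auto
  then have "u \<in> g -` {g u} \<inter> space P \<longleftrightarrow> v \<in> g -` {g u} \<inter> space P"
  proof induction
    case (Basic A)
    then show ?case using sm as uv by auto
  qed (use uv in auto)
  then show ?thesis using uv by auto
qed

lemma alive_le: "alive S e a t u \<Longrightarrow> 1 \<le> t \<Longrightarrow> 1 \<le> a \<and> a \<le> t"
  using adm_time_presample[of e S u t] by (auto simp: alive_def)

text \<open>The two runs agree before time \<open>t\<close> by \<open>alive_resample\<close>, so
  only the value at index \<open>a\<close> could separate them. For \<open>a < t\<close> it is the
  value hidden by \<open>info_except\<close>, and for \<open>a = t\<close> it is too recent to be
  part of the information.\<close>

lemma infoP_const:
  fixes g :: "(nat \<Rightarrow> real) \<Rightarrow> ennreal"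
  assumes g: "g \<in> borel_measurable (infoP e (t - 1))" and t: "t \<in> {1..T}"
    and uv: "u \<in> space P" "v \<in> space P" and v: "\<And>k. k \<noteq> a \<Longrightarrow> v k = u k"
    and gen: "generic u" "generic v" and al: "alive S e a t u" "alive S e a t v"
  shows "g u = g v"
proof (rule infoP_separate[OF g uv])
  have a: "1 \<le> a" "a \<le> t" using alive_le[OF al(1)] t by auto
  have st: "state S u r = state S v r" if "r < t" for r
    using alive_resample[OF v gen a _ al(1)] al(2) t that by auto
  show sm: "sample S u r = sample S v r" if "r \<le> t - 1" for r
  proof -
    have "r < t" using that t by auto
    from st[OF this] show ?thesis by (simp add: sample_def)
  qed
  fix r assume r: "r \<in> {1..t - 1}"
  have as: "assigned S u r = assigned S v r" if "r \<noteq> a"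
    using sm[of "r - 1"] r v[OF that] by (auto simp: assigned_def admitted_at_def)
  have eq: "e \<in> sample S u (t - 1) \<and> r = adm_time S u e (t - 1) \<longleftrightarrow>
    e \<in> sample S v (t - 1) \<and> r = adm_time S v e (t - 1)"
    using st[of "t - 1"] t by (simp add: sample_def adm_time_def)
  show "assigned_except S u e (t - 1) r = assigned_except S v e (t - 1) r"
  proof (cases "r = a")
    case True
    then have "a \<le> t - 1" "Suc (t - 1) = t" using r by auto
    then have "e \<in> sample S u (t - 1)" "adm_time S u e (t - 1) = a"
      using al(1) alive_Suc[of a "t - 1" S e u] a by (auto simp: alive_def)
    then show ?thesis using eq True by (simp add: assigned_except_def)
  next
    case False
    then show ?thesis using eq as by (simp add: assigned_except_def)
  qed
qed

text \<open>With \<open>g\<close> constant in \<open>x\<close> as long as \<open>e\<close> is alive,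
  the left side at a sampling time is \<open>g\<close> times \<pi> / p times the length p of the
  interval of retention; the right side is \<open>g\<close> times the length \<pi> of the interval
  in which \<open>e\<close> is alive. The indicator removes the runs for which these interval
  descriptions may fail.\<close>

lemma resampling_identity:
  fixes g :: "(nat \<Rightarrow> real) \<Rightarrow> ennreal"
  assumes g: "g \<in> borel_measurable (infoP e (t - 1))" and t: "t \<in> {1..T}" and a: "a \<in> {1..T}"
    and u: "u \<in> space (PiM ({1..T} - {a}) (\<lambda>_. unif))"
  defines "F \<equiv> \<lambda>v. if e \<in> sample S v t \<and> alive S e a t v
      then ennreal (1 / cond_prob_ret S v e t) * g v else 0"
    and "G \<equiv> \<lambda>v. if alive S e a t v then g v else 0"
  shows "(\<integral>\<^sup>+x. indicator {v. generic v} (u(a := x)) * F (u(a := x)) \<partial>unif) =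
    (\<integral>\<^sup>+x. indicator {v. generic v} (u(a := x)) * G (u(a := x)) \<partial>unif)"
\<comment> \<open>Either no generic value keeps \<open>e\<close> alive and both integrands vanish,
  or one such value \<open>y\<close> gives a reference point \<open>v\<close>, at which the
  quantities that do not depend on the coordinate are read off.\<close>
proof (cases "\<exists>y. generic (u(a := y)) \<and> alive S e a t (u(a := y))")
  case False
  then have "indicator {v. generic v} (u(a := x)) * F (u(a := x)) = 0"
    "indicator {v. generic v} (u(a := x)) * G (u(a := x)) = 0" for x
    by (auto simp: F_def G_def indicator_def)
  then show ?thesis by (simp only:)
next
  case True
  then obtain y where y: "generic (u(a := y))" "alive S e a t (u(a := y))" by blast
  define v where "v = u(a := y)"
  define \<pi> where "\<pi> = prior_prob S v e t"
  define c where "c = cur_weight S v e t / other_threshold S v e t"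
  note v = y[folded v_def]
  have vP: "v \<in> space P" unfolding v_def by (rule fun_upd_space_PiM_unif[OF a u])
  have at: "1 \<le> a" "a \<le> t" "t \<le> T" using alive_le[OF v(2)] t by auto
  have pos: "\<And>k. k \<in> {1..T} \<Longrightarrow> 0 < v k" using generic_pos[OF v(1)] .
  have ev: "e \<in> presample S v t" using v(2) by (simp add: alive_def)
  have \<pi>: "0 < \<pi>" "\<pi> \<le> 1"
    using prior_prob_bounds[of v e t, OF pos ev t] by (auto simp: \<pi>_def)
  have AEg: "AE x in unif. generic (u(a := x))" by (rule AE_generic_upd[OF y(1) a])
  have off: "\<And>k. k \<noteq> a \<Longrightarrow> (u(a := x)) k = v k" for x by (simp add: v_def)
  have al: "alive S e a t (u(a := x)) \<longleftrightarrow> x < \<pi>" if "generic (u(a := x))" for x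
    using alive_resample[OF off v(1) that at v(2)] by (simp add: \<pi>_def)
  have st: "state S v (t - 1) = state S (u(a := x)) (t - 1)"
    and pr: "prior_prob S (u(a := x)) e t = \<pi>"
    if "generic (u(a := x))" "x < \<pi>" for x
    using alive_resample[OF off v(1) that(1) at v(2)] al[OF that(1)] that(2) t by (auto simp: \<pi>_def)
  have gv: "g (u(a := x)) = g v" if "generic (u(a := x))" "x < \<pi>" for x
    using infoP_const[OF g t vP fun_upd_space_PiM_unif[OF a u] off v(1) that(1) v(2)]
      al[OF that(1)] that(2) by simp
  have same: "sampling_time S (u(a := x)) t = sampling_time S v t"
    "cur_weight S (u(a := x)) e t = cur_weight S v e t"
    "other_threshold S (u(a := x)) e t = other_threshold S v e t"
    if "generic (u(a := x))" "x < \<pi>" for x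
    using same_past[OF off t v(2) _ st[OF that]] al[OF that(1)] that(2) by auto
  have G: "indicator {v. generic v} (u(a := x)) * G (u(a := x)) = g v * indicator {0<..<\<pi>} x"
    if "generic (u(a := x))" for x
    using that al[OF that] gv[OF that] generic_pos[OF that a]
    by (auto simp: G_def indicator_def)
  show ?thesis
  proof (cases "sampling_time S v t")
    case False
    \<comment> \<open>Nothing is discarded and the conditional probability is 1, so even the
      integrands agree.\<close>
    have "F (u(a := x)) = G (u(a := x))" if gx: "generic (u(a := x))" for x
    proof (cases "x < \<pi>")
      case lt: True
      have "\<not> sampling_time S (u(a := x)) t" using same[OF gx lt] False by simp
      moreover have "e \<in> presample S (u(a := x)) t" using al[OF gx] lt by (simp add: alive_def)
      ultimately show ?thesis
        using sample_not_sampling_time[of S "u(a := x)" t] t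
        by (simp add: F_def G_def cond_prob_ret_def)
    qed (use al[OF gx] in \<open>simp add: F_def G_def\<close>)
    then have "indicator {v. generic v} (u(a := x)) * F (u(a := x)) =
      indicator {v. generic v} (u(a := x)) * G (u(a := x))" for x
      by (simp add: indicator_def)
    then show ?thesis by simp
  next
    case True
    \<comment> \<open>The length of the set of \<open>x\<close> that meet both the earlier bound and
      the cutoff at time \<open>t\<close>; wherever \<open>e\<close> is retained,
      \<open>cond_prob_ret\<close> equals \<open>p / \<pi>\<close>.\<close>
    define p where "p = min \<pi> c"
    have c: "0 < c"
    proof -
      have "0 < other_threshold S v e t"
        using priority_pos[of v, OF pos _ t] finite_presample[of S v t] others_nonempty[OF True, of e]
        by (simp add: other_threshold_def Min_gr_iff)
      then show ?thesis using cur_weight_pos[OF ev t] by (simp add: c_def)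
    qed
    then have p: "0 < p" "p \<le> 1" using \<pi> by (auto simp: p_def)
    have F: "indicator {v. generic v} (u(a := x)) * F (u(a := x)) =
      ennreal (\<pi> / p) * g v * indicator {0<..<p} x" if gx: "generic (u(a := x))" for x
    proof (cases "x < \<pi>")
      case lt: True
      have alx: "alive S e a t (u(a := x))" using al[OF gx] lt by simp
      then have ex: "e \<in> presample S (u(a := x)) t" "adm_time S (u(a := x)) e t = a"
        by (auto simp: alive_def)
      have sx: "sampling_time S (u(a := x)) t" using same[OF gx lt] True by simp
      have ret: "e \<in> sample S (u(a := x)) t \<longleftrightarrow> x < c"
        using retained_iff[OF gx sx at(3) ex(1)] same[OF gx lt] ex(2) by (simp add: c_def)
      have "cond_prob_ret S (u(a := x)) e t = p / \<pi>" if "x < c"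
        using ret that sx ret_prob_retained[OF sx] same[OF gx lt] pr[OF gx lt]
        by (simp add: cond_prob_ret_def p_def c_def)
      moreover have "0 < x" using generic_pos[OF gx a] by simp
      ultimately show ?thesis
        using gx alx ret lt gv[OF gx lt] by (auto simp: F_def indicator_def p_def)
    qed (use al[OF gx] in \<open>simp add: F_def p_def\<close>)
    have "(\<integral>\<^sup>+x. indicator {v. generic v} (u(a := x)) * F (u(a := x)) \<partial>unif) =
      (\<integral>\<^sup>+x. ennreal (\<pi> / p) * g v * indicator {0<..<p} x \<partial>unif)"
      using AEg F by (intro nn_integral_cong_AE) auto
    also have "\<dots> = ennreal (\<pi> / p) * g v * ennreal p"
      using p by (simp add: nn_integral_cmult_indicator emeasure_unif_Ioo)
    also have "\<dots> = g v * (ennreal (\<pi> / p) * ennreal p)" by (simp add: mult_ac)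
    also have "ennreal (\<pi> / p) * ennreal p = ennreal \<pi>"
      using p \<pi> by (simp flip: ennreal_mult)
    also have "g v * ennreal \<pi> = (\<integral>\<^sup>+x. g v * indicator {0<..<\<pi>} x \<partial>unif)"
      using \<pi> by (simp add: nn_integral_cmult_indicator emeasure_unif_Ioo)
    also have "\<dots> = (\<integral>\<^sup>+x. indicator {v. generic v} (u(a := x)) * G (u(a := x)) \<partial>unif)"
      using AEg G by (intro nn_integral_cong_AE) auto
    finally show ?thesis .
  qed
qed

text \<open>Both integrands are sums over the possible admission times \<open>a\<close>, and for
  each \<open>a\<close> Tonelli's theorem reduces the claim to \<open>resampling_identity\<close>.
  The measurability statements serve the transport to \<open>M\<close>.\<close>

lemma inverse_probability_P:
  fixes g :: "(nat \<Rightarrow> real) \<Rightarrow> ennreal"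
  assumes g: "g \<in> borel_measurable (infoP e (t - 1))" and t: "t \<in> {1..T}"
  shows "(\<integral>\<^sup>+u. (if e \<in> sample S u t then ennreal (1 / cond_prob_ret S u e t) * g u else 0) \<partial>P) =
    (\<integral>\<^sup>+u. (if e \<in> presample S u t then g u else 0) \<partial>P)" (is ?int)
    and "(\<lambda>u. if e \<in> sample S u t then ennreal (1 / cond_prob_ret S u e t) * g u else 0)
      \<in> borel_measurable P" (is ?F)
    and "(\<lambda>u. if e \<in> presample S u t then g u else 0) \<in> borel_measurable P" (is ?G)
proof -
  define F where "F a v = (if e \<in> sample S v t \<and> alive S e a t v
    then ennreal (1 / cond_prob_ret S v e t) * g v else 0)" for a v
  define G where "G a v = (if alive S e a t v then g v else 0)" for a v
  have n: "Suc (t - 1) = t" using t by simp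
  have comp: "\<And>r. r \<in> {1..T} \<Longrightarrow> (\<lambda>u. u r) \<in> borel_measurable P" by (rule component_P)
  have sm: "(\<lambda>u. sample S u r) \<in> P \<rightarrow>\<^sub>M count_space UNIV" if "r \<le> T" for r
    using measurable_sample_of_values[of T "\<lambda>u. u" P] comp that by auto
  have gP: "g \<in> borel_measurable P"
    by (rule measurable_info_except_mono[OF comp g]) (use t in auto)
  have pre: "Measurable.pred P (\<lambda>u. e \<in> presample S u t)"
  proof -
    have "t - 1 \<le> T" using t by auto
    from measurable_compose_count[OF measurable_presample_Suc[OF sm[OF this]], of "\<lambda>A. e \<in> A"]
    show ?thesis unfolding n .
  qed
  have adm: "(\<lambda>u. adm_time S u e t) \<in> P \<rightarrow>\<^sub>M count_space UNIV"
    using sm t by (intro measurable_adm_time[where u="\<lambda>u. u"]) auto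
  have al: "Measurable.pred P (alive S e a t)" for a
    using pre measurable_compose_count[OF adm, of "\<lambda>k. k = a"]
    unfolding alive_def by (intro pred_intros_logic) auto
  have post: "Measurable.pred P (\<lambda>u. e \<in> sample S u t)"
    using measurable_compose_count[OF sm[of t], of "\<lambda>A. e \<in> A"] t by simp
  have q: "(\<lambda>u. if e \<in> sample S u t then cond_prob_ret S u e t else 1) \<in> borel_measurable P"
    using measurable_cond_prob_ret_info_except[of "t - 1" e "\<lambda>k u. u k" P, unfolded n] t
    by (intro measurable_info_except_mono[where U="\<lambda>k u. u k" and e=e and s=t, OF comp])
      auto
  \<comment> \<open>Measurability of \<open>cond_prob_ret\<close> is available under the guard that
    \<open>e\<close> is retained, hence the inner conditional.\<close>
  have "(\<lambda>v. if e \<in> sample S v t \<and> alive S e a t v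
      then ennreal (1 / (if e \<in> sample S v t then cond_prob_ret S v e t else 1)) * g v else 0)
    \<in> borel_measurable P" for a
    using q gP post al by (intro measurable_if_pred pred_intros_logic) auto
  then have F [measurable]: "F a \<in> borel_measurable P" for a
    unfolding F_def by (rule measurable_cong[THEN iffD1, rotated]) auto
  have G [measurable]: "G a \<in> borel_measurable P" for a
    unfolding G_def using gP al by (intro measurable_if_pred) auto
  have FG: "(\<integral>\<^sup>+u. F a u \<partial>P) = (\<integral>\<^sup>+u. G a u \<partial>P)" if a: "a \<in> {1..T}" for a
  proof -
    let ?I = "indicator {v. generic v} :: _ \<Rightarrow> ennreal"
    have [measurable]: "?I \<in> borel_measurable P"
      using measurable_generic by (simp add: borel_measurable_indicator_iff Int_def conj_commute)
    have "(\<integral>\<^sup>+u. F a u \<partial>P) = (\<integral>\<^sup>+u. ?I u * F a u \<partial>P)"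
      using AE_generic by (intro nn_integral_cong_AE) auto
    also have "\<dots> = (\<integral>\<^sup>+u. (\<integral>\<^sup>+x. ?I (u(a := x)) * F a (u(a := x)) \<partial>unif) \<partial>PiM ({1..T} - {a}) (\<lambda>_. unif))"
      by (rule nn_integral_PiM_unif_coord[OF a]) measurable
    also have "\<dots> = (\<integral>\<^sup>+u. (\<integral>\<^sup>+x. ?I (u(a := x)) * G a (u(a := x)) \<partial>unif) \<partial>PiM ({1..T} - {a}) (\<lambda>_. unif))"
      unfolding F_def G_def by (intro nn_integral_cong resampling_identity[OF g t a])
    also have "\<dots> = (\<integral>\<^sup>+u. ?I u * G a u \<partial>P)"
      by (rule nn_integral_PiM_unif_coord[OF a, symmetric]) measurable
    also have "\<dots> = (\<integral>\<^sup>+u. G a u \<partial>P)"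
      using AE_generic by (intro nn_integral_cong_AE) auto
    finally show ?thesis .
  qed
  \<comment> \<open>The admission time of \<open>e\<close> takes exactly one value, so at most one
    summand is nonzero.\<close>
  have F_sum: "(if e \<in> sample S u t then ennreal (1 / cond_prob_ret S u e t) * g u else 0) =
    (\<Sum>a\<in>{1..T}. F a u)" for u
  proof (cases "e \<in> sample S u t")
    case True
    then have "e \<in> presample S u t" using sample_subset_presample t by auto
    then have *: "adm_time S u e t \<in> {1..T}" "alive S e a t u \<longleftrightarrow> a = adm_time S u e t" for a
      using adm_time_presample[of e S u t] t by (auto simp: alive_def)
    show ?thesis using True *(1) by (simp add: F_def *(2) sum.delta)
  qed (simp add: F_def)
  have G_sum: "(if e \<in> presample S u t then g u else 0) = (\<Sum>a\<in>{1..T}. G a u)" for u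
  proof (cases "e \<in> presample S u t")
    case True
    then have *: "adm_time S u e t \<in> {1..T}" "alive S e a t u \<longleftrightarrow> a = adm_time S u e t" for a
      using adm_time_presample[of e S u t] t by (auto simp: alive_def)
    show ?thesis using True *(1) by (simp add: G_def *(2) sum.delta)
  qed (simp add: G_def alive_def)
  show ?F unfolding F_sum by (intro borel_measurable_sum F)
  show ?G unfolding G_sum by (intro borel_measurable_sum G)
  show ?int
    unfolding F_sum G_sum nn_integral_sum[OF F] nn_integral_sum[OF G] by (rule sum.cong[OF refl FG])
qed

end

text \<open>A form of the Doob-Dynkin factorisation: indicators factor by assumption, and
  factorisations pass to multiples, sums and suprema.\<close>

lemma borel_measurable_factor:
  fixes X :: "'a \<Rightarrow> ennreal"
  assumes "X \<in> borel_measurable N"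
    and sets: "\<And>A. A \<in> sets N \<Longrightarrow> \<exists>B\<in>sets N'. A = h -` B \<inter> space N"
  shows "\<exists>g\<in>borel_measurable N'. \<forall>\<omega>\<in>space N. X \<omega> = g (h \<omega>)"
  using assms(1)
proof (induction rule: borel_measurable_induct)
  case (cong f g)
  then show ?case by auto
next
  case (set A)
  then obtain B where "B \<in> sets N'" "A = h -` B \<inter> space N" using sets by blast
  then show ?case by (intro bexI[of _ "indicator B"]) (auto simp: indicator_def)
next
  case (mult u c)
  then obtain g where "g \<in> borel_measurable N'" "\<forall>\<omega>\<in>space N. u \<omega> = g (h \<omega>)" by blast
  then show ?case by (intro bexI[of _ "\<lambda>y. c * g y"]) auto
next
  case (add u v)
  then obtain g g' where "g \<in> borel_measurable N'" "\<forall>\<omega>\<in>space N. u \<omega> = g (h \<omega>)"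
    "g' \<in> borel_measurable N'" "\<forall>\<omega>\<in>space N. v \<omega> = g' (h \<omega>)" by blast
  then show ?case by (intro bexI[of _ "\<lambda>y. g' y + g y"]) auto
next
  case (seq U)
  then have "\<forall>i. \<exists>g\<in>borel_measurable N'. \<forall>\<omega>\<in>space N. U i \<omega> = g (h \<omega>)" by blast
  then obtain G where "\<And>i. G i \<in> borel_measurable N'" "\<And>i \<omega>. \<omega> \<in> space N \<Longrightarrow> U i \<omega> = G i (h \<omega>)"
    by metis
  then show ?case by (intro bexI[of _ "\<lambda>y. SUP i. G i y"]) (auto simp: image_comp)
qed

section \<open>Extended expectations\<close>

text \<open>Here \<open>f\<close> and \<open>g\<close> may both be nonzero at a point, so they need
  not be the positive and negative parts of the difference. Pointwise, \<open>g\<close> plus the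
  positive part of \<open>f - g\<close> equals \<open>f\<close> plus its negative part; integrating
  and cancelling the finite integral of \<open>g\<close> gives the claim.\<close>

lemma has_ext_expectation_diff:
  assumes [measurable]: "f \<in> borel_measurable M" "g \<in> borel_measurable M"
    and nonneg: "\<And>\<omega>. \<omega> \<in> space M \<Longrightarrow> 0 \<le> f \<omega>" "\<And>\<omega>. \<omega> \<in> space M \<Longrightarrow> 0 \<le> g \<omega>"
    and fin: "(\<integral>\<^sup>+\<omega>. ennreal (g \<omega>) \<partial>M) < \<infinity>"
    and eq: "(\<integral>\<^sup>+\<omega>. ennreal (f \<omega>) \<partial>M) = c + (\<integral>\<^sup>+\<omega>. ennreal (g \<omega>) \<partial>M)"
  shows "has_ext_expectation M (\<lambda>\<omega>. f \<omega> - g \<omega>) c"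
proof -
  have "(\<integral>\<^sup>+\<omega>. ennreal (- (f \<omega> - g \<omega>)) \<partial>M) \<le> (\<integral>\<^sup>+\<omega>. ennreal (g \<omega>) \<partial>M)"
    using nonneg by (intro nn_integral_mono ennreal_leI) auto
  then have "(\<integral>\<^sup>+\<omega>. ennreal (- (f \<omega> - g \<omega>)) \<partial>M) < \<infinity>"
    using fin by (rule le_less_trans)
  moreover have "(\<integral>\<^sup>+\<omega>. ennreal (g \<omega>) \<partial>M) + (\<integral>\<^sup>+\<omega>. ennreal (f \<omega> - g \<omega>) \<partial>M) =
    (\<integral>\<^sup>+\<omega>. ennreal (g \<omega>) \<partial>M) + (c + (\<integral>\<^sup>+\<omega>. ennreal (- (f \<omega> - g \<omega>)) \<partial>M))"
  proof -
    have pt: "ennreal b + ennreal (a - b) = ennreal a + ennreal (- (a - b))"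
      if "0 \<le> a" "0 \<le> b" for a b :: real
      using that by (cases "a \<le> b") (auto simp: ennreal_neg simp flip: ennreal_plus)
    have "(\<integral>\<^sup>+\<omega>. ennreal (g \<omega>) \<partial>M) + (\<integral>\<^sup>+\<omega>. ennreal (f \<omega> - g \<omega>) \<partial>M) =
      (\<integral>\<^sup>+\<omega>. ennreal (g \<omega>) + ennreal (f \<omega> - g \<omega>) \<partial>M)"
      by (intro nn_integral_add[symmetric]) measurable
    also have "\<dots> = (\<integral>\<^sup>+\<omega>. ennreal (f \<omega>) + ennreal (- (f \<omega> - g \<omega>)) \<partial>M)"
      using nonneg by (intro nn_integral_cong pt)
    also have "\<dots> = (\<integral>\<^sup>+\<omega>. ennreal (f \<omega>) \<partial>M) + (\<integral>\<^sup>+\<omega>. ennreal (- (f \<omega> - g \<omega>)) \<partial>M)"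
      by (intro nn_integral_add) measurable
    finally show ?thesis by (simp add: eq add_ac)
  qed
  ultimately show ?thesis
    using fin unfolding has_ext_expectation_def ennreal_add_left_cancel by auto
qed

text \<open>If the second moment is infinite, so is the variance, because the two integrands differ
  by an integrable affine function of \<open>X\<close>; both sides are then \<infinity>.\<close>

lemma (in prob_space) nn_integral_square_eq_ext_variance:
  assumes X: "integrable M X"
  shows "(\<integral>\<^sup>+\<omega>. ennreal ((X \<omega>)\<^sup>2) \<partial>M) = ext_variance M X + ennreal ((expectation X)\<^sup>2)"
proof (cases "integrable M (\<lambda>\<omega>. (X \<omega>)\<^sup>2)")
  case True
  then have "(\<integral>\<^sup>+\<omega>. ennreal ((X \<omega>)\<^sup>2) \<partial>M) = ennreal (expectation (\<lambda>\<omega>. (X \<omega>)\<^sup>2))"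
    by (intro nn_integral_eq_integral) auto
  also have "expectation (\<lambda>\<omega>. (X \<omega>)\<^sup>2) = variance X + (expectation X)\<^sup>2"
    using variance_eq[OF X True] by simp
  also have "ennreal \<dots> = ext_variance M X + ennreal ((expectation X)\<^sup>2)"
    unfolding ext_variance_eq[OF X True] by (intro ennreal_plus variance_positive) simp
  finally show ?thesis .
next
  case False
  have [measurable]: "X \<in> borel_measurable M" using X by simp
  have "\<not> integrable M (\<lambda>\<omega>. (X \<omega> - expectation X)\<^sup>2)"
  proof
    assume "integrable M (\<lambda>\<omega>. (X \<omega> - expectation X)\<^sup>2)"
    then have "integrable M (\<lambda>\<omega>. (X \<omega> - expectation X)\<^sup>2 + (2 * expectation X * X \<omega> - (expectation X)\<^sup>2))"
      using X by simp
    also have "(\<lambda>\<omega>. (X \<omega> - expectation X)\<^sup>2 + (2 * expectation X * X \<omega> - (expectation X)\<^sup>2)) =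
      (\<lambda>\<omega>. (X \<omega>)\<^sup>2)"
      by (simp add: fun_eq_iff power2_diff algebra_simps power2_eq_square)
    finally show False using False by simp
  qed
  then have "ext_variance M X = \<infinity>"
    unfolding ext_variance_def by (subst (asm) integrable_iff_bounded) (auto simp flip: less_top)
  moreover have "(\<integral>\<^sup>+\<omega>. ennreal ((X \<omega>)\<^sup>2) \<partial>M) = \<infinity>"
    using False by (subst (asm) integrable_iff_bounded) (auto simp flip: less_top)
  ultimately show ?thesis by simp
qed

section \<open>The scheme on a probability space\<close>

locale random_reservoir = reservoir S E T + prob_space M
  for S :: "'v scheme" and E T and M :: "'a measure" +
  fixes U :: "nat \<Rightarrow> 'a \<Rightarrow> real"
  assumes T_pos: "1 \<le> T"
    and indep: "indep_vars (\<lambda>_. borel) U {1..T}"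
    and U_range: "\<And>s \<omega>. s \<in> {1..T} \<Longrightarrow> \<omega> \<in> space M \<Longrightarrow> U s \<omega> \<in> {0<..1}"
    and U_distr: "\<And>s. s \<in> {1..T} \<Longrightarrow> distr M borel (U s) = unif"
begin

abbreviation u :: "'a \<Rightarrow> nat \<Rightarrow> real" where
  "u \<omega> \<equiv> (\<lambda>k. U k \<omega>)"

text \<open>The restriction makes this a point of the product space \<open>P\<close>, whose elements
  are \<open>undefined\<close> outside \<open>{1..T}\<close>.\<close>

definition path :: "'a \<Rightarrow> nat \<Rightarrow> real" where
  "path \<omega> = (\<lambda>k\<in>{1..T}. U k \<omega>)"

lemma U_measurable: "s \<in> {1..T} \<Longrightarrow> U s \<in> borel_measurable M"
  using indep by (simp add: indep_vars_def)

lemma U_pos: "\<omega> \<in> space M \<Longrightarrow> k \<in> {1..T} \<Longrightarrow> 0 < U k \<omega>"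
  using U_range by force

lemma path_eq: "k \<in> {1..T} \<Longrightarrow> path \<omega> k = U k \<omega>"
  by (simp add: path_def)

lemma measurable_path: "path \<in> M \<rightarrow>\<^sub>M P"
  unfolding path_def using U_measurable by (intro measurable_restrict) auto

lemma path_space: "\<omega> \<in> space M \<Longrightarrow> path \<omega> \<in> space P"
  by (rule measurable_space[OF measurable_path])

text \<open>Independence and the uniform marginals are combined into a single statement about the
  joint law.\<close>

lemma distr_path: "distr M P path = P"
proof -
  have "distr M P path = distr M (PiM {1..T} (\<lambda>_. borel)) (\<lambda>\<omega>. \<lambda>k\<in>{1..T}. U k \<omega>)"
    by (intro distr_cong sets_PiM_cong) (auto simp: path_def)
  also have "\<dots> = PiM {1..T} (\<lambda>k. distr M borel (U k))"
    using indep T_pos U_measurable by (subst indep_vars_iff_distr_eq_PiM'[symmetric]) auto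
  also have "\<dots> = P" by (intro PiM_cong) (auto simp: U_distr)
  finally show ?thesis .
qed

lemma sample_path: "n \<le> T \<Longrightarrow> sample S (path \<omega>) n = sample S (u \<omega>) n"
  and adm_time_path: "n \<le> T \<Longrightarrow> adm_time S (path \<omega>) e n = adm_time S (u \<omega>) e n"
  using state_cong[of n "path \<omega>" "u \<omega>" S] path_eq by (auto simp: sample_def adm_time_def)

lemma assigned_except_path:
  assumes "r \<le> s" "s \<le> T"
  shows "assigned_except S (path \<omega>) e s r = assigned_except S (u \<omega>) e s r"
proof (cases "r = 0")
  case False
  then show ?thesis
    using assms by (simp add: assigned_except_def assigned_def admitted_at_def sample_path
        adm_time_path path_eq)
qed simp

text \<open>The generators on \<open>M\<close> are preimages of the generators on \<open>P\<close>,
  and taking preimages commutes with generating a sigma-algebra.\<close>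

lemma sets_info_except_path:
  assumes "A \<in> sets (info_except M S U e s)" "s \<le> T"
  shows "\<exists>B\<in>sets (infoP e s). A = path -` B \<inter> space (info_except M S U e s)"
proof -
  let ?G = "\<lambda>\<Omega> (v :: _ \<Rightarrow> nat \<Rightarrow> real). {{\<omega> \<in> \<Omega>. sample S (v \<omega>) r = A} | r A. r \<le> s} \<union>
    {(\<lambda>\<omega>. assigned_except S (v \<omega>) e s r) -` B \<inter> \<Omega> | r B. r \<in> {1..s} \<and> B \<in> sets borel}"
  have sub: "?G (space M) u \<subseteq> {path -` A \<inter> space M | A. A \<in> ?G (space P) (\<lambda>v. v)}"
  proof
    fix A assume "A \<in> ?G (space M) u"
    then consider r A' where "A = {\<omega> \<in> space M. sample S (u \<omega>) r = A'}" "r \<le> s"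
      | r B where "A = (\<lambda>\<omega>. assigned_except S (u \<omega>) e s r) -` B \<inter> space M" "r \<in> {1..s}" "B \<in> sets borel"
      by auto
    then show "A \<in> {path -` A \<inter> space M | A. A \<in> ?G (space P) (\<lambda>v. v)}"
    proof cases
      case 1
      then have "A = path -` {v \<in> space P. sample S v r = A'} \<inter> space M"
        using path_space assms(2) by (auto simp: sample_path)
      with 1 show ?thesis by blast
    next
      case 2
      then have "A = path -` ((\<lambda>v. assigned_except S v e s r) -` B \<inter> space P) \<inter> space M"
        using path_space assms(2) by (auto simp: assigned_except_path)
      with 2 show ?thesis by blast
    qed
  qed
  have "A \<in> sigma_sets (space M) (?G (space M) u)"
    using assms(1) unfolding info_except_def by (subst (asm) sets_measure_of) auto
  then have "A \<in> sigma_sets (space M) {path -` A \<inter> space M | A. A \<in> ?G (space P) (\<lambda>v. v)}"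
    using sigma_sets_mono'[OF sub] by blast
  also have "\<dots> = {path -` A \<inter> space M | A. A \<in> sigma_sets (space P) (?G (space P) (\<lambda>v. v))}"
    using path_space by (intro sigma_sets_vimage_commute[symmetric]) auto
  also have "sigma_sets (space P) (?G (space P) (\<lambda>v. v)) = sets (infoP e s)"
    unfolding info_except_def by (subst sets_measure_of) auto
  finally show ?thesis by auto
qed

text \<open>Transport from the product space: \<open>X\<close> factors through \<open>path\<close>,
  whose law is \<open>P\<close>.\<close>

lemma inverse_probability:
  fixes X :: "'a \<Rightarrow> ennreal"
  assumes X: "X \<in> borel_measurable (info_except M S U e (t - 1))" and t: "t \<in> {1..T}"
  shows "(\<integral>\<^sup>+\<omega>. (if e \<in> sample S (u \<omega>) t then ennreal (1 / cond_prob_ret S (u \<omega>) e t) * X \<omega> else 0) \<partial>M) =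
    (\<integral>\<^sup>+\<omega>. (if e \<in> presample S (u \<omega>) t then X \<omega> else 0) \<partial>M)"
proof -
  have t': "t - 1 \<le> T" "t \<le> T" "1 \<le> t" using t by auto
  have "\<exists>g\<in>borel_measurable (infoP e (t - 1)).
    \<forall>\<omega>\<in>space (info_except M S U e (t - 1)). X \<omega> = g (path \<omega>)"
    using sets_info_except_path t' by (intro borel_measurable_factor[OF X]) auto
  then obtain g where g: "g \<in> borel_measurable (infoP e (t - 1))"
    and Xg: "\<And>\<omega>. \<omega> \<in> space M \<Longrightarrow> X \<omega> = g (path \<omega>)" by auto
  note P = inverse_probability_P[OF g t]
  have pre: "presample S (path \<omega>) t = presample S (u \<omega>) t" for \<omega>
    using t' by (simp add: presample_def sample_path)
  have q: "cond_prob_ret S (path \<omega>) e t = cond_prob_ret S (u \<omega>) e t" if "e \<in> sample S (u \<omega>) t" for \<omega>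
  proof (rule cond_prob_ret_cong[OF t'(3)])
    show "e \<in> presample S (path \<omega>) t"
      using that sample_subset_presample[OF t'(3)] by (auto simp: pre)
  qed (use t' path_eq in auto)
  have "(\<integral>\<^sup>+\<omega>. (if e \<in> sample S (u \<omega>) t then ennreal (1 / cond_prob_ret S (u \<omega>) e t) * X \<omega> else 0) \<partial>M) =
    (\<integral>\<^sup>+\<omega>. (if e \<in> sample S (path \<omega>) t
      then ennreal (1 / cond_prob_ret S (path \<omega>) e t) * g (path \<omega>) else 0) \<partial>M)"
    using t' by (intro nn_integral_cong) (simp add: q Xg sample_path)
  also have "\<dots> = (\<integral>\<^sup>+v. (if e \<in> sample S v t then ennreal (1 / cond_prob_ret S v e t) * g v else 0)
      \<partial>distr M P path)"
    by (rule nn_integral_distr[OF measurable_path, unfolded measurable_distr_eq1, OF P(2), symmetric])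
  also have "\<dots> = (\<integral>\<^sup>+v. (if e \<in> presample S v t then g v else 0) \<partial>distr M P path)"
    unfolding distr_path by (rule P(1))
  also have "\<dots> = (\<integral>\<^sup>+\<omega>. (if e \<in> presample S (path \<omega>) t then g (path \<omega>) else 0) \<partial>M)"
    by (rule nn_integral_distr[OF measurable_path, unfolded measurable_distr_eq1, OF P(3)])
  also have "\<dots> = (\<integral>\<^sup>+\<omega>. (if e \<in> presample S (u \<omega>) t then X \<omega> else 0) \<partial>M)"
    by (intro nn_integral_cong) (simp add: pre Xg)
  finally show ?thesis .
qed

lemma q_bounds:
  assumes "\<omega> \<in> space M" "e \<in> sample S (u \<omega>) (Suc n)" "Suc n \<le> T"
  shows "0 < cond_prob_ret S (u \<omega>) e (Suc n) \<and> cond_prob_ret S (u \<omega>) e (Suc n) \<le> 1"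
  using cond_prob_ret_bounds[of "u \<omega>" e "Suc n"] U_pos[OF assms(1)] assms(2,3)
    sample_Suc_subset[of S "u \<omega>" n] by auto

text \<open>Vanishing off the presample removes the indicator on the right. A negative
  \<open>Y\<close> is truncated to 0 by \<open>ennreal\<close> on both sides alike, since the
  probability is positive.\<close>

lemma inverse_probability_stored:
  fixes Y :: "'a \<Rightarrow> real"
  assumes "Y \<in> borel_measurable (info_except M S U e n)" "Suc n \<le> T"
    and "\<And>\<omega>. \<omega> \<in> space M \<Longrightarrow> e \<notin> presample S (u \<omega>) (Suc n) \<Longrightarrow> Y \<omega> = 0"
  shows "(\<integral>\<^sup>+\<omega>. (if e \<in> sample S (u \<omega>) (Suc n)
      then ennreal (Y \<omega> / cond_prob_ret S (u \<omega>) e (Suc n)) else 0) \<partial>M) = (\<integral>\<^sup>+\<omega>. ennreal (Y \<omega>) \<partial>M)"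
proof -
  have pt: "ennreal (Y \<omega> / cond_prob_ret S (u \<omega>) e (Suc n)) =
    ennreal (1 / cond_prob_ret S (u \<omega>) e (Suc n)) * ennreal (Y \<omega>)"
    if "\<omega> \<in> space M" "e \<in> sample S (u \<omega>) (Suc n)" for \<omega>
  proof -
    have "0 < cond_prob_ret S (u \<omega>) e (Suc n)"
      using q_bounds[OF that assms(2)] by simp
    then show ?thesis by (simp flip: ennreal_mult')
  qed
  have "(\<lambda>\<omega>. ennreal (Y \<omega>)) \<in> borel_measurable (info_except M S U e (Suc n - 1))"
    using assms(1) by simp
  from inverse_probability[OF this] assms(2)
  have "(\<integral>\<^sup>+\<omega>. (if e \<in> sample S (u \<omega>) (Suc n)
      then ennreal (1 / cond_prob_ret S (u \<omega>) e (Suc n)) * ennreal (Y \<omega>) else 0) \<partial>M) =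
    (\<integral>\<^sup>+\<omega>. (if e \<in> presample S (u \<omega>) (Suc n) then ennreal (Y \<omega>) else 0) \<partial>M)" by auto
  also have "\<dots> = (\<integral>\<^sup>+\<omega>. ennreal (Y \<omega>) \<partial>M)"
    using assms(3) by (intro nn_integral_cong) auto
  finally show ?thesis using pt by (simp cong: nn_integral_cong if_cong)
qed

section \<open>Mean and variance of the count estimate\<close>

abbreviation C :: "'v uprod \<Rightarrow> nat \<Rightarrow> 'a \<Rightarrow> real" where
  "C e n \<omega> \<equiv> count_est S (u \<omega>) e n"

abbreviation hit :: "'v uprod \<Rightarrow> nat \<Rightarrow> real" where
  "hit e n \<equiv> of_bool (arrival S n = e)"

lemma C_nonneg: "n \<le> T \<Longrightarrow> \<omega> \<in> space M \<Longrightarrow> 0 \<le> C e n \<omega>"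
  using U_pos by (intro count_est_nonneg) auto

lemma measurable_C: "n \<le> T \<Longrightarrow> C e n \<in> borel_measurable M"
  by (rule measurable_info_except_mono[OF U_measurable measurable_count_est_info_except])

lemma C_hit_eq_0: "e \<notin> presample S (u \<omega>) (Suc n) \<Longrightarrow> C e n \<omega> + hit e (Suc n) = 0"
  by (auto simp: presample_def count_est_eq_0)

lemma nn_integral_C_Suc:
  assumes n: "Suc n \<le> T"
  shows "(\<integral>\<^sup>+\<omega>. ennreal (C e (Suc n) \<omega>) \<partial>M) = (\<integral>\<^sup>+\<omega>. ennreal (C e n \<omega> + hit e (Suc n)) \<partial>M)"
proof -
  have "(\<lambda>\<omega>. C e n \<omega> + hit e (Suc n)) \<in> borel_measurable (info_except M S U e n)"
    using measurable_count_est_info_except[where n=n and M=M and U=U and e=e] n by simp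
  from inverse_probability_stored[OF this n C_hit_eq_0] show ?thesis
    by (simp add: if_distrib[where f=ennreal] cong: if_cong)
qed

text \<open>From one time to the next the mean only grows by the new count, so it stays finite even
  if 1 / q is unbounded. A finite mean allows its square to be cancelled in the variance
  recursion.\<close>

lemma integrable_C: "n \<le> T \<Longrightarrow> integrable M (C e n)"
proof (induction n)
  case (Suc n)
  have "integrable M (\<lambda>\<omega>. C e n \<omega> + hit e (Suc n))" using Suc by simp
  then have "(\<integral>\<^sup>+\<omega>. ennreal (C e n \<omega> + hit e (Suc n)) \<partial>M) < \<infinity>"
    using C_nonneg[of n _ e] Suc.prems by (subst nn_integral_eq_integral) auto
  then have "(\<integral>\<^sup>+\<omega>. ennreal (C e (Suc n) \<omega>) \<partial>M) < \<infinity>"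
    by (simp only: nn_integral_C_Suc[OF Suc.prems])
  then show ?case
    using measurable_C[OF Suc.prems] C_nonneg[OF Suc.prems] by (intro integrableI_nonneg) auto
qed simp

lemma expectation_C_Suc:
  assumes "Suc n \<le> T"
  shows "expectation (C e (Suc n)) = expectation (C e n) + hit e (Suc n)"
proof -
  have "expectation (C e (Suc n)) = expectation (\<lambda>\<omega>. C e n \<omega> + hit e (Suc n))"
    using C_nonneg[OF assms] C_nonneg[of n _ e] measurable_C[OF assms] measurable_C[of n e] assms
      nn_integral_C_Suc[OF assms]
    by (subst (1 2) integral_eq_nn_integral) (auto simp del: count_est.simps)
  also have "\<dots> = expectation (C e n) + hit e (Suc n)"
    using integrable_C[of n e] assms by (simp add: prob_space)
  finally show ?thesis .
qed

lemma ext_variance_C_hit: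
  assumes "n \<le> T"
  shows "ext_variance M (\<lambda>\<omega>. C e n \<omega> + hit e (Suc n)) = ext_variance M (C e n)"
  using integrable_C[OF assms, of e] by (simp add: ext_variance_def prob_space)

lemma measurable_q:
  assumes "Suc n \<le> T"
  shows "(\<lambda>\<omega>. if e \<in> sample S (u \<omega>) (Suc n) then cond_prob_ret S (u \<omega>) e (Suc n) else 1)
    \<in> borel_measurable M"
  using assms
  by (intro measurable_info_except_mono[OF U_measurable measurable_cond_prob_ret_info_except]) auto

lemma measurable_quotient:
  assumes "Y \<in> borel_measurable M" "Suc n \<le> T"
  shows "(\<lambda>\<omega>. if e \<in> sample S (u \<omega>) (Suc n) then Y \<omega> / cond_prob_ret S (u \<omega>) e (Suc n) else 0)
    \<in> borel_measurable M"
proof -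
  have "Measurable.pred M (\<lambda>\<omega>. e \<in> sample S (u \<omega>) (Suc n))"
    using assms(2)
    by (intro measurable_info_except_mono[OF U_measurable pred_sample_info_except[OF order_refl]]) auto
  then have "(\<lambda>\<omega>. if e \<in> sample S (u \<omega>) (Suc n) then Y \<omega> /
      (if e \<in> sample S (u \<omega>) (Suc n) then cond_prob_ret S (u \<omega>) e (Suc n) else 1) else 0)
    \<in> borel_measurable M"
    by (rule measurable_if_pred[OF _ borel_measurable_divide[OF assms(1) measurable_q[OF assms(2)]]
          borel_measurable_const])
  then show ?thesis by (simp cong: if_cong)
qed

text \<open>Off the sample \<open>cond_prob_ret\<close> may be replaced by 1, because it is
  multiplied by a count estimate of 0 there.\<close>

lemma measurable_count_variation:
  assumes n: "Suc n \<le> T"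
  shows "(\<lambda>\<omega>. (C e (Suc n) \<omega>)\<^sup>2 * (1 - cond_prob_ret S (u \<omega>) e (Suc n))) \<in> borel_measurable M"
proof -
  have "(\<lambda>\<omega>. (C e (Suc n) \<omega>)\<^sup>2 * (1 - (if e \<in> sample S (u \<omega>) (Suc n)
    then cond_prob_ret S (u \<omega>) e (Suc n) else 1))) \<in> borel_measurable M"
    using measurable_q[OF n, of e] measurable_C[OF n, of e]
    by (intro borel_measurable_times borel_measurable_power borel_measurable_diff) auto
  also have "(\<lambda>\<omega>. (C e (Suc n) \<omega>)\<^sup>2 * (1 - (if e \<in> sample S (u \<omega>) (Suc n)
    then cond_prob_ret S (u \<omega>) e (Suc n) else 1))) =
    (\<lambda>\<omega>. (C e (Suc n) \<omega>)\<^sup>2 * (1 - cond_prob_ret S (u \<omega>) e (Suc n)))"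
    by (auto simp: fun_eq_iff count_est_eq_0 simp del: count_est.simps)
  finally show ?thesis .
qed

text \<open>The first summand of \<open>var_step\<close> accounts for exactly the variance added at
  one step. Adding the new count shifts the estimate by a constant, so all new variance comes from
  the discard.\<close>

lemma ext_variance_C_Suc:
  assumes n: "Suc n \<le> T"
  shows "ext_variance M (C e (Suc n)) = ext_variance M (C e n) +
    (\<integral>\<^sup>+\<omega>. ennreal ((C e (Suc n) \<omega>)\<^sup>2 * (1 - cond_prob_ret S (u \<omega>) e (Suc n))) \<partial>M)"
proof -
  let ?q = "\<lambda>\<omega>. cond_prob_ret S (u \<omega>) e (Suc n)"
  define x where "x \<omega> = C e n \<omega> + hit e (Suc n)" for \<omega>
  have int: "integrable M (C e (Suc n))" "integrable M x"
    using integrable_C[OF n, of e] integrable_C[of n e] n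
    by (simp_all add: x_def[abs_def] del: count_est.simps)
  have xm: "x \<in> borel_measurable (info_except M S U e n)"
    using measurable_count_est_info_except[where n=n and M=M and U=U and e=e] n
    by (simp add: x_def[abs_def])
  have sq: "(\<lambda>\<omega>. (C e (Suc n) \<omega>)\<^sup>2 * (1 - ?q \<omega>)) \<in> borel_measurable M"
    using measurable_count_variation[OF n] .
  have "(\<lambda>\<omega>. (x \<omega>)\<^sup>2) \<in> borel_measurable M" using int(2) by simp
  from measurable_compose[OF measurable_quotient[OF this n, of e] measurable_ennreal]
  have qm: "(\<lambda>\<omega>. if e \<in> sample S (u \<omega>) (Suc n) then ennreal ((x \<omega>)\<^sup>2 / ?q \<omega>) else 0)
    \<in> borel_measurable M"
    by (simp add: if_distrib[where f=ennreal] cong: if_cong)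
  have x0: "x \<omega> = 0" if "e \<notin> presample S (u \<omega>) (Suc n)" for \<omega>
    unfolding x_def by (rule C_hit_eq_0[OF that])
  have x_sq: "(\<integral>\<^sup>+\<omega>. (if e \<in> sample S (u \<omega>) (Suc n) then ennreal ((x \<omega>)\<^sup>2 / ?q \<omega>) else 0) \<partial>M) =
    (\<integral>\<^sup>+\<omega>. ennreal ((x \<omega>)\<^sup>2) \<partial>M)"
    using x0 by (intro inverse_probability_stored[OF borel_measurable_power[OF xm] n]) simp
  have pt: "ennreal ((C e (Suc n) \<omega>)\<^sup>2) = ennreal ((C e (Suc n) \<omega>)\<^sup>2 * (1 - ?q \<omega>)) +
    (if e \<in> sample S (u \<omega>) (Suc n) then ennreal ((x \<omega>)\<^sup>2 / ?q \<omega>) else 0)" if "\<omega> \<in> space M" for \<omega>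
  proof (cases "e \<in> sample S (u \<omega>) (Suc n)")
    case True
    have q: "0 < ?q \<omega>" "?q \<omega> \<le> 1" using q_bounds[OF that True n] by auto
    \<comment> \<open>On retention the new estimate is \<open>x \<omega> / ?q \<omega>\<close>, so
      its square times \<open>?q \<omega>\<close> is
      \<open>(x \<omega>)\<^sup>2 / ?q \<omega>\<close>.\<close>
    have "(C e (Suc n) \<omega>)\<^sup>2 = (C e (Suc n) \<omega>)\<^sup>2 * (1 - ?q \<omega>) + (x \<omega>)\<^sup>2 / ?q \<omega>"
      using q True by (simp add: x_def field_simps power2_eq_square)
    then have "ennreal ((C e (Suc n) \<omega>)\<^sup>2) =
      ennreal ((C e (Suc n) \<omega>)\<^sup>2 * (1 - ?q \<omega>) + (x \<omega>)\<^sup>2 / ?q \<omega>)" by (rule arg_cong)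
    also have "\<dots> = ennreal ((C e (Suc n) \<omega>)\<^sup>2 * (1 - ?q \<omega>)) + ennreal ((x \<omega>)\<^sup>2 / ?q \<omega>)"
      using q by (intro ennreal_plus) auto
    finally show ?thesis using True by (simp del: count_est.simps)
  qed (simp add: count_est_eq_0)
  have "ext_variance M (C e (Suc n)) + ennreal ((expectation (C e (Suc n)))\<^sup>2) =
    (\<integral>\<^sup>+\<omega>. ennreal ((C e (Suc n) \<omega>)\<^sup>2) \<partial>M)"
    by (rule nn_integral_square_eq_ext_variance[OF int(1), symmetric])
  also have "\<dots> = (\<integral>\<^sup>+\<omega>. ennreal ((C e (Suc n) \<omega>)\<^sup>2 * (1 - ?q \<omega>)) +
    (if e \<in> sample S (u \<omega>) (Suc n) then ennreal ((x \<omega>)\<^sup>2 / ?q \<omega>) else 0) \<partial>M)"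
    by (intro nn_integral_cong pt)
  also have "\<dots> = (\<integral>\<^sup>+\<omega>. ennreal ((C e (Suc n) \<omega>)\<^sup>2 * (1 - ?q \<omega>)) \<partial>M) +
    (\<integral>\<^sup>+\<omega>. ennreal ((x \<omega>)\<^sup>2) \<partial>M)"
    unfolding x_sq[symmetric]
    by (rule nn_integral_add[OF measurable_compose[OF sq measurable_ennreal] qm])
  also have "(\<integral>\<^sup>+\<omega>. ennreal ((x \<omega>)\<^sup>2) \<partial>M) = ext_variance M x + ennreal ((expectation x)\<^sup>2)"
    by (rule nn_integral_square_eq_ext_variance[OF int(2)])
  also have "ext_variance M x = ext_variance M (C e n)"
    unfolding x_def using n by (intro ext_variance_C_hit) simp
  also have "expectation x = expectation (C e (Suc n))"
    unfolding x_def using integrable_C[of n e] n expectation_C_Suc[OF n, of e] by (simp add: prob_space)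
  finally have "ennreal ((expectation (C e (Suc n)))\<^sup>2) + ext_variance M (C e (Suc n)) =
    ennreal ((expectation (C e (Suc n)))\<^sup>2) + (ext_variance M (C e n) +
      (\<integral>\<^sup>+\<omega>. ennreal ((C e (Suc n) \<omega>)\<^sup>2 * (1 - ?q \<omega>)) \<partial>M))"
    by (simp only: ac_simps)
  then show ?thesis by (simp only: ennreal_add_left_cancel) auto
qed

text \<open>As \<open>V\<close> may be negative, the identity for inverse probabilities is applied
  to its two parts. The nonnegative first summand of \<open>var_step\<close> joins the positive part
  in \<open>f\<close>; the integral of \<open>g\<close> is finite because the negative part of
  \<open>V\<close> has a finite integral.\<close>

lemma has_ext_expectation_var_step:
  assumes n: "Suc n \<le> T" and V: "stored_with M S U e n V"
    and EV: "has_ext_expectation M V (ext_variance M (C e n))"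
  shows "has_ext_expectation M (\<lambda>\<omega>. var_step S (u \<omega>) e (Suc n) (V \<omega>)) (ext_variance M (C e (Suc n)))"
proof -
  let ?q = "\<lambda>\<omega>. cond_prob_ret S (u \<omega>) e (Suc n)"
  let ?F = "\<lambda>\<omega>. e \<in> sample S (u \<omega>) (Suc n)"
  let ?w = "\<lambda>\<omega>. (C e (Suc n) \<omega>)\<^sup>2 * (1 - ?q \<omega>)"
  define Vp Vn where "Vp \<omega> = max 0 (V \<omega>)" and "Vn \<omega> = max 0 (- V \<omega>)" for \<omega>
  define f g where "f \<omega> = ?w \<omega> + (if ?F \<omega> then Vp \<omega> / ?q \<omega> else 0)"
    and "g \<omega> = (if ?F \<omega> then Vn \<omega> / ?q \<omega> else 0)" for \<omega>
  have Vm: "V \<in> borel_measurable (info_except M S U e n)" using V by (simp add: stored_with_def)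
  then have Vpn: "Vp \<in> borel_measurable (info_except M S U e n)" "Vn \<in> borel_measurable (info_except M S U e n)"
    unfolding Vp_def Vn_def by measurable
  have V0: "Vp \<omega> = 0" "Vn \<omega> = 0" if "\<omega> \<in> space M" "e \<notin> presample S (u \<omega>) (Suc n)" for \<omega>
    using V that by (auto simp: stored_with_def presample_def Vp_def Vn_def)
  have VpnM: "Vp \<in> borel_measurable M" "Vn \<in> borel_measurable M"
    using measurable_info_except_mono[OF U_measurable Vpn(1)]
      measurable_info_except_mono[OF U_measurable Vpn(2)] n by auto
  have w: "?w \<in> borel_measurable M" by (rule measurable_count_variation[OF n])
  have w0: "0 \<le> ?w \<omega>" if "\<omega> \<in> space M" for \<omega>
  proof (cases "?F \<omega>")
    case True
    then show ?thesis using q_bounds[OF that _ n] by auto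
  qed (simp add: count_est_eq_0 del: count_est.simps)
  have ep: "(\<integral>\<^sup>+\<omega>. ennreal (if ?F \<omega> then Vp \<omega> / ?q \<omega> else 0) \<partial>M) = (\<integral>\<^sup>+\<omega>. ennreal (V \<omega>) \<partial>M)"
    using inverse_probability_stored[OF Vpn(1) n V0(1)]
    by (simp add: if_distrib[where f=ennreal] Vp_def cong: if_cong)
  have en: "(\<integral>\<^sup>+\<omega>. ennreal (g \<omega>) \<partial>M) = (\<integral>\<^sup>+\<omega>. ennreal (- V \<omega>) \<partial>M)"
    using inverse_probability_stored[OF Vpn(2) n V0(2)]
    by (simp add: if_distrib[where f=ennreal] g_def Vn_def cong: if_cong)
  have p0: "0 \<le> (if ?F \<omega> then Vp \<omega> / ?q \<omega> else 0)" "0 \<le> g \<omega>" if "\<omega> \<in> space M" for \<omega>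
    using q_bounds[OF that _ n] by (auto simp: Vp_def Vn_def g_def less_imp_le)
  have qm: "(\<lambda>\<omega>. if ?F \<omega> then Vp \<omega> / ?q \<omega> else 0) \<in> borel_measurable M" "g \<in> borel_measurable M"
    unfolding g_def using measurable_quotient[OF _ n] VpnM by auto
  have "has_ext_expectation M (\<lambda>\<omega>. f \<omega> - g \<omega>) (ext_variance M (C e (Suc n)))"
  proof (rule has_ext_expectation_diff)
    show "f \<in> borel_measurable M" unfolding f_def using w qm(1) by (rule borel_measurable_add)
    show "g \<in> borel_measurable M" by (rule qm)
    show "0 \<le> f \<omega>" "0 \<le> g \<omega>" if "\<omega> \<in> space M" for \<omega>
      unfolding f_def using w0 p0 that by (auto intro: add_nonneg_nonneg simp del: count_est.simps)
    show "(\<integral>\<^sup>+\<omega>. ennreal (g \<omega>) \<partial>M) < \<infinity>"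
      using EV by (simp add: en has_ext_expectation_def)
    have "(\<integral>\<^sup>+\<omega>. ennreal (f \<omega>) \<partial>M) =
      (\<integral>\<^sup>+\<omega>. ennreal (?w \<omega>) + ennreal (if ?F \<omega> then Vp \<omega> / ?q \<omega> else 0) \<partial>M)"
      unfolding f_def using w0 p0 by (intro nn_integral_cong ennreal_plus)
    also have "\<dots> = (\<integral>\<^sup>+\<omega>. ennreal (?w \<omega>) \<partial>M) + (\<integral>\<^sup>+\<omega>. ennreal (V \<omega>) \<partial>M)"
      unfolding ep[symmetric] using w qm(1) by (intro nn_integral_add measurable_compose[OF _ measurable_ennreal])
    also have "(\<integral>\<^sup>+\<omega>. ennreal (V \<omega>) \<partial>M) = ext_variance M (C e n) + (\<integral>\<^sup>+\<omega>. ennreal (g \<omega>) \<partial>M)"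
      using EV by (simp add: en has_ext_expectation_def)
    finally show "(\<integral>\<^sup>+\<omega>. ennreal (f \<omega>) \<partial>M) =
      ext_variance M (C e (Suc n)) + (\<integral>\<^sup>+\<omega>. ennreal (g \<omega>) \<partial>M)"
      unfolding ext_variance_C_Suc[OF n] by (simp only: ac_simps)
  qed
  moreover have "f \<omega> - g \<omega> = var_step S (u \<omega>) e (Suc n) (V \<omega>)" for \<omega>
    by (auto simp: f_def g_def var_step_def Vp_def Vn_def max_def diff_divide_distrib[symmetric]
        simp del: count_est.simps)
  ultimately show ?thesis by simp
qed

end

theorem theorem2:
  fixes M :: "'a measure"
    and S :: "'v scheme"
    and U :: "nat \<Rightarrow> 'a \<Rightarrow> real"
    and E :: "'v uprod set"
    and T t :: nat
    and e :: "'v uprod"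
    and V :: "'a \<Rightarrow> real"
  assumes "prob_space M"
    and "finite E"
    and "\<forall>s\<in>{1..T}. arrival S s \<in> E"
    and "1 \<le> capacity S"
    and "\<forall>i\<in>E. \<forall>a s. 1 \<le> a \<and> a \<le> s \<and> s \<le> T \<longrightarrow> 0 < weight S i a s"
    and "prob_space.indep_vars M (\<lambda>_. borel) U {1..T}"
    and "\<forall>s\<in>{1..T}. \<forall>\<omega>\<in>space M. U s \<omega> \<in> {0<..1}"
    and "\<forall>s\<in>{1..T}. distr M borel (U s) = uniform_measure lborel {0<..1}"
    and "e \<in> E"
    and "1 \<le> t" and "t \<le> T"
    and "V \<in> borel_measurable (info M S U (t - 1))"
    and "stored_with M S U e (t - 1) V"
    and "has_ext_expectation M V
           (ext_variance M (\<lambda>\<omega>. count_est S (\<lambda>k. U k \<omega>) e (t - 1)))"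
  shows "(\<lambda>\<omega>. var_step S (\<lambda>k. U k \<omega>) e t (V \<omega>)) \<in> borel_measurable (info M S U t) \<and>
    stored_with M S U e t (\<lambda>\<omega>. var_step S (\<lambda>k. U k \<omega>) e t (V \<omega>)) \<and>
    has_ext_expectation M (\<lambda>\<omega>. var_step S (\<lambda>k. U k \<omega>) e t (V \<omega>))
      (ext_variance M (\<lambda>\<omega>. count_est S (\<lambda>k. U k \<omega>) e t))"
proof -
  interpret prob_space M by fact
  interpret random_reservoir S E T M U
    using assms(2-8,10,11) by unfold_locales (auto simp: unif_def)
  obtain n where t: "t = Suc n" using assms(10) by (cases t) auto
  have n: "Suc n \<le> T" using assms(11) t by simp
  have V: "stored_with M S U e n V" using assms(13) t by simp
  have meas: "(\<lambda>\<omega>. var_step S (\<lambda>k. U k \<omega>) e (Suc n) (V \<omega>)) \<in>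
    borel_measurable (info_except M S U e (Suc n))"
    by (rule measurable_var_step_info_except[OF V n])
  moreover have "stored_with M S U e (Suc n) (\<lambda>\<omega>. var_step S (\<lambda>k. U k \<omega>) e (Suc n) (V \<omega>))"
    using meas by (simp add: stored_with_def var_step_eq_0)
  moreover have "has_ext_expectation M (\<lambda>\<omega>. var_step S (\<lambda>k. U k \<omega>) e (Suc n) (V \<omega>))
      (ext_variance M (\<lambda>\<omega>. count_est S (\<lambda>k. U k \<omega>) e (Suc n)))"
    using assms(14) t by (intro has_ext_expectation_var_step[OF n V]) simp
  ultimately show ?thesis
    unfolding t using measurable_info_mono[OF meas n] by blast
qed

end
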